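(* Let $G$ be a finitely generated group without epimorphism $G\twoheadrightarrow\mathbf{Z}$. Then every $G$-equivariant conditional mean on $\ell^\infty(G)$ is $G$-invariant. Likewise, every $G$-equivariant vector pricing on $\ell^\infty(G)$ is $G$-invariant.
   Context: $V=\ell^\infty(G)$ is the space of all bounded real functions on $G$ with the pointwise order, positive cone $V^+$ and $G$-action $(gf)(x)=f(g^{-1}x)$. A conditional mean on $V$ is a function $P$ with values in $[0,1]$ defined on all pairs $0\leq u\leq v\neq 0$ in $V$ (value $P(u|v)$) such that: (CM1) $P(u+v|w)=P(u|w)+P(v|w)$ when $u,v\geq 0$, $u+v\leq w\neq 0$; (CM2) $P(u|w)=P(u|v)P(v|w)$ when $0\leq u\leq v\leq w$, $v\neq 0$; (CM3) $P(u|u)=1$ when $u\geq 0$, $u\neq 0$. It is $G$-invariant if $P(gu|v)=P(u|v)$ for all $g\in G$ whenever $0\leq u,gu\leq v\neq 0$, and $G$-equivariant if $P(gu|gv)=P(u|v)$ for all $g\in G$ and $0\leq u\leq v\neq 0$. A vector pricing on $V$ is a map $r\colon V^+\times V^+\to[0,+\infty]$ such that for all $u,v,w\in V^+$: (VP1) $r(u+v,w)=r(u,w)+r(v,w)$ when $w\neq 0$; (VP2) $r(u,w)=r(u,v)\,r(v,w)$ when defined (only the product of $0$ and $+\infty$ is undefined); (VP3) $r(u,u)=1$. It is $G$-invariant if $r(gu,v)=r(u,v)$, and $G$-equivariant if $r(gu,gv)=r(u,v)$, for all $g\in G$, $u,v\in V^+$. *)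

theory Defs
  imports
    "HOL-Analysis.Analysis"
    "HOL-Algebra.Elementary_Groups"
    "HOL-Library.Function_Algebras"
begin

definition finitely_generated_group :: "('a, 'b) monoid_scheme \<Rightarrow> bool" where
  "finitely_generated_group G \<longleftrightarrow>
     group G \<and> (\<exists>S. finite S \<and> S \<subseteq> carrier G \<and> generate G S = carrier G)"

text \<open>Bounded functions on the carrier are represented by their extension by zero to the whole type.
  On these representatives equality, addition, zero and the order of the function type are the
  pointwise ones over the carrier.\<close>

definition ell_infty :: "('a, 'b) monoid_scheme \<Rightarrow> ('a \<Rightarrow> real) set" where
  "ell_infty G = {f. bounded (f ` carrier G) \<and> (\<forall>x. x \<notin> carrier G \<longrightarrow> f x = 0)}"

definition ell_infty_pos :: "('a, 'b) monoid_scheme \<Rightarrow> ('a \<Rightarrow> real) set" where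
  "ell_infty_pos G = {f \<in> ell_infty G. 0 \<le> f}"

definition translate :: "('a, 'b) monoid_scheme \<Rightarrow> 'a \<Rightarrow> ('a \<Rightarrow> real) \<Rightarrow> 'a \<Rightarrow> real" where
  "translate G g f = (\<lambda>x. if x \<in> carrier G then f (inv\<^bsub>G\<^esub> g \<otimes>\<^bsub>G\<^esub> x) else 0)"

text \<open>A conditional mean is a partial function; here it is a total function \<open>P\<close> of which only the
  values \<open>P u v\<close> with \<open>0 \<le> u \<le> v \<noteq> 0\<close> in \<open>ell_infty G\<close> are constrained or used.
  Write \<open>P u v\<close> for \<open>P(u|v)\<close>.\<close>

definition cond_pair :: "('a, 'b) monoid_scheme \<Rightarrow> ('a \<Rightarrow> real) \<Rightarrow> ('a \<Rightarrow> real) \<Rightarrow> bool" where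
  "cond_pair G u v \<longleftrightarrow> u \<in> ell_infty G \<and> v \<in> ell_infty G \<and> 0 \<le> u \<and> u \<le> v \<and> v \<noteq> 0"

definition conditional_mean ::
    "('a, 'b) monoid_scheme \<Rightarrow> (('a \<Rightarrow> real) \<Rightarrow> ('a \<Rightarrow> real) \<Rightarrow> real) \<Rightarrow> bool" where
  "conditional_mean G P \<longleftrightarrow>
     (\<forall>u v. cond_pair G u v \<longrightarrow> P u v \<in> {0..1}) \<and>
     (\<forall>u\<in>ell_infty G. \<forall>v\<in>ell_infty G. \<forall>w\<in>ell_infty G.
        0 \<le> u \<and> 0 \<le> v \<and> u + v \<le> w \<and> w \<noteq> 0 \<longrightarrow> P (u + v) w = P u w + P v w) \<and>
     (\<forall>u\<in>ell_infty G. \<forall>v\<in>ell_infty G. \<forall>w\<in>ell_infty G.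
        0 \<le> u \<and> u \<le> v \<and> v \<le> w \<and> v \<noteq> 0 \<longrightarrow> P u w = P u v * P v w) \<and>
     (\<forall>u\<in>ell_infty G. 0 \<le> u \<and> u \<noteq> 0 \<longrightarrow> P u u = 1)"

definition cm_invariant ::
    "('a, 'b) monoid_scheme \<Rightarrow> (('a \<Rightarrow> real) \<Rightarrow> ('a \<Rightarrow> real) \<Rightarrow> real) \<Rightarrow> bool" where
  "cm_invariant G P \<longleftrightarrow>
     (\<forall>g\<in>carrier G. \<forall>u v. cond_pair G u v \<and> cond_pair G (translate G g u) v \<longrightarrow>
        P (translate G g u) v = P u v)"

definition cm_equivariant ::
    "('a, 'b) monoid_scheme \<Rightarrow> (('a \<Rightarrow> real) \<Rightarrow> ('a \<Rightarrow> real) \<Rightarrow> real) \<Rightarrow> bool" where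
  "cm_equivariant G P \<longleftrightarrow>
     (\<forall>g\<in>carrier G. \<forall>u v. cond_pair G u v \<longrightarrow>
        P (translate G g u) (translate G g v) = P u v)"

text \<open>In \<open>ennreal\<close> the product of \<open>0\<close> and \<open>\<infinity>\<close> is \<open>0\<close>, so the multiplicativity axiom
  explicitly excludes the cases in which the product is regarded as undefined.\<close>

definition mult_defined :: "ennreal \<Rightarrow> ennreal \<Rightarrow> bool" where
  "mult_defined a b \<longleftrightarrow> \<not> (a = 0 \<and> b = \<infinity>) \<and> \<not> (a = \<infinity> \<and> b = 0)"

definition vector_pricing ::
    "('a, 'b) monoid_scheme \<Rightarrow> (('a \<Rightarrow> real) \<Rightarrow> ('a \<Rightarrow> real) \<Rightarrow> ennreal) \<Rightarrow> bool" where
  "vector_pricing G r \<longleftrightarrow>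
     (\<forall>u\<in>ell_infty_pos G. \<forall>v\<in>ell_infty_pos G. \<forall>w\<in>ell_infty_pos G.
        (w \<noteq> 0 \<longrightarrow> r (u + v) w = r u w + r v w) \<and>
        (mult_defined (r u v) (r v w) \<longrightarrow> r u w = r u v * r v w) \<and>
        r u u = 1)"

definition vp_invariant ::
    "('a, 'b) monoid_scheme \<Rightarrow> (('a \<Rightarrow> real) \<Rightarrow> ('a \<Rightarrow> real) \<Rightarrow> ennreal) \<Rightarrow> bool" where
  "vp_invariant G r \<longleftrightarrow>
     (\<forall>g\<in>carrier G. \<forall>u\<in>ell_infty_pos G. \<forall>v\<in>ell_infty_pos G. r (translate G g u) v = r u v)"

definition vp_equivariant ::
    "('a, 'b) monoid_scheme \<Rightarrow> (('a \<Rightarrow> real) \<Rightarrow> ('a \<Rightarrow> real) \<Rightarrow> ennreal) \<Rightarrow> bool" where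
  "vp_equivariant G r \<longleftrightarrow>
     (\<forall>g\<in>carrier G. \<forall>u\<in>ell_infty_pos G. \<forall>v\<in>ell_infty_pos G.
        r (translate G g u) (translate G g v) = r u v)"

end

theory Submission
  imports Defs "HOL-Library.Diagonal_Subsequence"
begin

text \<open>A conditional mean \<open>P\<close> yields the vector pricing \<open>P(u|u+v) / P(v|u+v)\<close>, so it suffices to treat an
  equivariant vector pricing \<open>r\<close>. If \<open>r(gu,u)\<close> is positive and finite for all \<open>g\<close>, then
  \<open>g \<mapsto> ln r(gu,u)\<close> is a homomorphism to the reals; a finitely generated group that does not map onto the
  integers has no nonzero one, so \<open>r(gu,u) = 1\<close> and \<open>r(gu,v) = r(gu,u) r(u,v) = r(u,v)\<close>.

  The remaining possibility is excluded by an argument of Witte Morris. The relation \<open>r(xu,yu) < \<infinity>\<close> is a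
  left invariant total preorder on the group, and \<open>f \<mapsto> r(f,1)\<close> is an invariant mean. Poincare recurrence
  for this mean, followed by a diagonal limit of right translates of the preorder, turns a nontrivial
  preorder into a nontrivial recurrent one. For a recurrent preorder, counting how far an element moves
  points along the orbit of the largest generator and averaging the result gives again a nonzero
  homomorphism to the reals.\<close>

section \<open>Homomorphisms to the reals\<close>

lemma finite_common_denominator:
  fixes q :: "'a \<Rightarrow> rat"
  assumes "finite S"
  obtains D :: nat where "D > 0" "\<And>s. s \<in> S \<Longrightarrow> of_nat D * q s \<in> \<int>"
proof -
  have "\<exists>D::nat. D > 0 \<and> (\<forall>s\<in>S. of_nat D * q s \<in> \<int>)"
    using assms
  proof induction
    case empty
    show ?case by auto
  next
    case (insert a S)
    then obtain D :: nat where D: "D > 0" "\<forall>s\<in>S. of_nat D * q s \<in> \<int>" by blast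
    obtain m n where mn: "q a = of_int m / of_int n" "n > 0"
      by (metis quotient_of_div quotient_of_denom_pos surj_pair)
    define E where "E = D * nat n"
    have E: "(of_nat E :: rat) = of_nat D * of_int n"
      using mn(2) by (simp add: E_def)
    have "of_nat E * q s \<in> \<int>" if "s \<in> insert a S" for s
    proof (cases "s = a")
      case True
      have "of_nat E * q a = of_int (int D * m)"
        using mn by (simp add: E)
      then show ?thesis using True by (metis Ints_of_int)
    next
      case False
      then have "of_int n * (of_nat D * q s) \<in> \<int>"
        using D that by (intro Ints_mult[OF Ints_of_int]) auto
      then show ?thesis by (simp add: E mult_ac)
    qed
    moreover have "E > 0" using D(1) mn(2) by (simp add: E_def)
    ultimately show ?case by blast
  qed
  then show ?thesis using that by blast
qed

text \<open>The image of \<open>\<kappa>\<close> is a nonzero subgroup of the integers, hence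
  consists of the multiples of its least positive element \<open>d\<close>; dividing by
  \<open>d\<close> makes the map surjective.\<close>

lemma epi_integer_group_of_nonzero:
  fixes G :: "('a, 'b) monoid_scheme" (structure) and \<kappa> :: "'a \<Rightarrow> int"
  assumes "group G"
    and add: "\<And>x y. x \<in> carrier G \<Longrightarrow> y \<in> carrier G \<Longrightarrow> \<kappa> (x \<otimes> y) = \<kappa> x + \<kappa> y"
    and g: "g \<in> carrier G" "\<kappa> g \<noteq> 0"
  shows "epi G integer_group \<noteq> {}"
proof -
  interpret group G by fact
  have "\<kappa> \<in> hom G integer_group"
    using add by (auto simp: hom_def)
  then have \<kappa>: "group_hom G integer_group \<kappa>"
    by (simp add: group_hom_def group_hom_axioms_def is_group)
  have pow: "\<kappa> (x [^] (n::int)) = n * \<kappa> x" if "x \<in> carrier G" for x n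
    using group_hom.hom_int_pow[OF \<kappa> that] by simp
  define P where "P d \<longleftrightarrow> d > 0 \<and> (\<exists>h\<in>carrier G. \<kappa> h = int d)" for d :: nat
  have "P (nat \<bar>\<kappa> g\<bar>)"
    using g unfolding P_def
    by (auto intro!: bexI[of _ "g [^] sgn (\<kappa> g)"] simp: pow abs_sgn[symmetric] mult.commute[of "sgn _"])
  then have P: "P (Least P)" and least: "\<And>d. P d \<Longrightarrow> Least P \<le> d"
    by (auto intro: LeastI Least_le)
  define d where "d = int (Least P)"
  obtain h where d: "d > 0" and h: "h \<in> carrier G" "\<kappa> h = d"
    using P unfolding P_def d_def by auto
  have dvd: "d dvd \<kappa> x" if x: "x \<in> carrier G" for x
  proof (rule ccontr)
    assume "\<not> d dvd \<kappa> x"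
    then have pos: "\<kappa> x mod d > 0"
      using pos_mod_sign[OF d, of "\<kappa> x"] by (simp add: dvd_eq_mod_eq_0 less_le)
    \<comment> \<open>A nonzero remainder would itself be a positive value of
      \<open>\<kappa>\<close> smaller than \<open>d\<close>.\<close>
    have "\<kappa> (x \<otimes> h [^] (- (\<kappa> x div d))) = \<kappa> x mod d"
      using x h by (simp add: add pow del: int_pow_neg) (simp add: minus_div_mult_eq_mod[symmetric])
    then have "P (nat (\<kappa> x mod d))"
      using pos x h unfolding P_def by (auto intro!: bexI[of _ "x \<otimes> h [^] (- (\<kappa> x div d))"])
    then show False
      using least[of "nat (\<kappa> x mod d)"] pos_mod_bound[OF d, of "\<kappa> x"] pos unfolding d_def by linarith
  qed
  define \<eta> where "\<eta> x = \<kappa> x div d" for x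
  have "\<eta> \<in> hom G integer_group"
    using add dvd by (auto simp: hom_def \<eta>_def)
  moreover have "n \<in> \<eta> ` carrier G" for n
    using h d pow[OF h(1), of n] by (intro image_eqI[of _ _ "h [^] n"]) (auto simp: \<eta>_def)
  ultimately have "\<eta> \<in> epi G integer_group"
    unfolding epi_def by (auto simp: carrier_integer_group)
  then show ?thesis by auto
qed

text \<open>A rational linear functional not vanishing at a given value makes a homomorphism to the reals
  rational; finite generation bounds the denominators.\<close>

lemma real_hom_trivial:
  fixes G :: "('a, 'b) monoid_scheme" (structure) and \<tau> :: "'a \<Rightarrow> real"
  assumes fg: "finitely_generated_group G" and epi: "epi G integer_group = {}"
    and add: "\<And>x y. x \<in> carrier G \<Longrightarrow> y \<in> carrier G \<Longrightarrow> \<tau> (x \<otimes> y) = \<tau> x + \<tau> y"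
    and g: "g \<in> carrier G"
  shows "\<tau> g = 0"
proof (rule ccontr)
  assume nz: "\<tau> g \<noteq> 0"
  obtain S where S: "finite S" "S \<subseteq> carrier G" "generate G S = carrier G" and "group G"
    using fg unfolding finitely_generated_group_def by auto
  interpret group G by fact
  interpret V: vector_space "\<lambda>(q::rat) (x::real). of_rat q * x"
    by unfold_locales (auto simp: algebra_simps of_rat_add of_rat_mult)
  have ind: "V.independent {\<tau> g}"
    using nz V.dependent_single by blast
  define B where "B = V.extend_basis {\<tau> g}"
  have B: "V.independent B" "V.span B = UNIV" "\<tau> g \<in> B"
    using V.independent_extend_basis[OF ind] V.span_extend_basis[OF ind]
      V.extend_basis_superset[OF ind] by (auto simp: B_def)
  \<comment> \<open>The rational functional is the coordinate along the basis vector
    \<open>\<tau> g\<close>, in a basis of the reals over the rationals that extends it; so it takes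
    the value 1 at \<open>g\<close>.\<close>
  define \<psi> where "\<psi> x = V.representation B (\<tau> x) (\<tau> g)" for x
  have \<psi>_add: "\<psi> (x \<otimes> y) = \<psi> x + \<psi> y" if "x \<in> carrier G" "y \<in> carrier G" for x y
    using B by (simp add: \<psi>_def add[OF that] V.representation_add)
  have \<psi>_g: "\<psi> g = 1"
    using V.representation_basis[OF B(1) B(3)] by (simp add: \<psi>_def)
  have \<psi>_one: "\<psi> \<one> = 0"
    using \<psi>_add[of \<one> \<one>] by simp
  have \<psi>_inv: "\<psi> (inv x) = - \<psi> x" if "x \<in> carrier G" for x
    using \<psi>_add[of x "inv x"] that \<psi>_one by (simp add: eq_neg_iff_add_eq_0 add.commute)
  obtain D :: nat where D: "D > 0" "\<And>s. s \<in> S \<Longrightarrow> of_nat D * \<psi> s \<in> \<int>"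
    using finite_common_denominator[OF S(1)] by blast
  have D_int: "of_nat D * \<psi> x \<in> \<int>" if "x \<in> carrier G" for x
  proof -
    have "x \<in> generate G S" using that S(3) by simp
    then show ?thesis
    proof induction
      case (eng x y)
      then have "x \<in> carrier G" "y \<in> carrier G" using S(3) by auto
      then show ?case using eng by (simp add: \<psi>_add distrib_left)
    qed (use D(2) S(2) in \<open>auto simp: \<psi>_one \<psi>_inv subset_iff\<close>)
  qed
  define \<kappa> where "\<kappa> x = \<lfloor>of_nat D * \<psi> x\<rfloor>" for x
  have \<kappa>: "of_int (\<kappa> x) = of_nat D * \<psi> x" if "x \<in> carrier G" for x
    using D_int[OF that] by (simp add: \<kappa>_def)
  have "\<kappa> (x \<otimes> y) = \<kappa> x + \<kappa> y" if "x \<in> carrier G" "y \<in> carrier G" for x y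
  proof -
    have "(of_int (\<kappa> (x \<otimes> y)) :: rat) = of_int (\<kappa> x + \<kappa> y)"
      using that by (simp add: \<kappa> \<psi>_add distrib_left)
    then show ?thesis by (simp only: of_int_eq_iff)
  qed
  moreover have "\<kappa> g \<noteq> 0"
    using D(1) by (simp add: \<kappa>_def \<psi>_g)
  ultimately show False
    using epi_integer_group_of_nonzero[OF is_group _ g, of \<kappa>] epi by blast
qed

section \<open>Left preorders\<close>

locale left_preorder = group G for G :: "('a, 'b) monoid_scheme" (structure) +
  fixes le :: "'a \<Rightarrow> 'a \<Rightarrow> bool" (infix \<open>\<sqsubseteq>\<close> 50)
  assumes total: "x \<in> carrier G \<Longrightarrow> y \<in> carrier G \<Longrightarrow> x \<sqsubseteq> y \<or> y \<sqsubseteq> x"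
    and trans: "x \<in> carrier G \<Longrightarrow> y \<in> carrier G \<Longrightarrow> z \<in> carrier G \<Longrightarrow> x \<sqsubseteq> y \<Longrightarrow> y \<sqsubseteq> z \<Longrightarrow> x \<sqsubseteq> z"
    and left: "g \<in> carrier G \<Longrightarrow> x \<in> carrier G \<Longrightarrow> y \<in> carrier G \<Longrightarrow> x \<sqsubseteq> y \<Longrightarrow> g \<otimes> x \<sqsubseteq> g \<otimes> y"
begin

text \<open>By totality the negated reverse relation is the strict part. Distinct elements may be
  equivalent.\<close>

abbreviation lt (infix \<open>\<sqsubset>\<close> 50) where "x \<sqsubset> y \<equiv> \<not> y \<sqsubseteq> x"

lemma refl: "x \<in> carrier G \<Longrightarrow> x \<sqsubseteq> x"
  using total by blast

lemma lt_imp_le: "x \<in> carrier G \<Longrightarrow> y \<in> carrier G \<Longrightarrow> x \<sqsubset> y \<Longrightarrow> x \<sqsubseteq> y"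
  using total by blast

lemma left_iff:
  assumes "g \<in> carrier G" "x \<in> carrier G" "y \<in> carrier G"
  shows "g \<otimes> x \<sqsubseteq> g \<otimes> y \<longleftrightarrow> x \<sqsubseteq> y"
proof
  assume "g \<otimes> x \<sqsubseteq> g \<otimes> y"
  then have "inv g \<otimes> (g \<otimes> x) \<sqsubseteq> inv g \<otimes> (g \<otimes> y)"
    using assms by - (rule left, auto)
  then show "x \<sqsubseteq> y" using assms by (simp add: m_assoc[symmetric])
qed (use assms left in auto)

end

text \<open>This is the property that Poincare recurrence provides; it is stronger than the Conradian
  property.\<close>

locale recurrent_left_preorder = left_preorder +
  assumes recurrent: "g \<in> carrier G \<Longrightarrow> h \<in> carrier G \<Longrightarrow> \<one> \<sqsubset> h \<Longrightarrow> \<exists>n::nat. n \<ge> 1 \<and> g [^] n \<sqsubset> h \<otimes> g [^] n"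
begin

text \<open>If \<open>h\<close> moves a point down, \<open>inv h\<close> moves it up, so recurrence
  for \<open>inv h\<close> gives recurrence for the reversed relation. This later reduces negative
  exponents to nonnegative ones.\<close>

lemma dual: "recurrent_left_preorder G (\<lambda>x y. y \<sqsubseteq> x)"
proof (unfold_locales, goal_cases)
  case (1 x y)
  then show ?case using total by blast
next
  case (2 x y z)
  then show ?case using trans[of z y x] by simp
next
  case (3 g x y)
  then show ?case using left by simp
next
  case (4 g h)
  then have gh: "g \<in> carrier G" "h \<in> carrier G" "\<not> \<one> \<sqsubseteq> h" by auto
  have "\<one> \<sqsubset> inv h"
  proof
    assume "inv h \<sqsubseteq> \<one>"
    then have "h \<otimes> inv h \<sqsubseteq> h \<otimes> \<one>" using gh by - (rule left, auto)
    then show False using gh by simp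
  qed
  then obtain n :: nat where n: "n \<ge> 1" "g [^] n \<sqsubset> inv h \<otimes> g [^] n"
    using recurrent[of g "inv h"] gh by auto
  have "\<not> g [^] n \<sqsubseteq> h \<otimes> g [^] n"
  proof
    assume "g [^] n \<sqsubseteq> h \<otimes> g [^] n"
    then have "inv h \<otimes> g [^] n \<sqsubseteq> inv h \<otimes> (h \<otimes> g [^] n)" using gh by - (rule left, auto)
    then show False using n gh by (simp add: m_assoc[symmetric])
  qed
  then show ?case using n by blast
qed

text \<open>Recurrence is assumed only at the identity and for one exponent. Conjugating
  \<open>g\<close> and \<open>h\<close> by a point \<open>z\<close> moves it to \<open>z\<close>,
  since \<open>z \<otimes> h' = h \<otimes> z\<close>; restarting at each point reached gives
  arbitrarily late exponents.\<close>

lemma recurrent_at: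
  assumes G: "y \<in> carrier G" "g \<in> carrier G" "h \<in> carrier G" and lt: "y \<sqsubset> h \<otimes> y"
  shows "\<exists>n\<ge>N::nat. g [^] n \<otimes> y \<sqsubset> h \<otimes> (g [^] n \<otimes> y)"
proof (induction N)
  case 0
  show ?case using G lt by (auto intro!: exI[of _ "0::nat"])
next
  case (Suc N)
  then obtain n where n: "n \<ge> N" "g [^] n \<otimes> y \<sqsubset> h \<otimes> (g [^] n \<otimes> y)" by blast
  define z where "z = g [^] n \<otimes> y"
  define g' where "g' = inv z \<otimes> (g \<otimes> z)"
  define h' where "h' = inv z \<otimes> (h \<otimes> z)"
  have z: "z \<in> carrier G" using G by (simp add: z_def)
  have G': "g' \<in> carrier G" "h' \<in> carrier G" using G z by (auto simp: g'_def h'_def)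
  have zg: "z \<otimes> g' = g \<otimes> z" and zh: "z \<otimes> h' = h \<otimes> z"
    using G z by (auto simp: g'_def h'_def m_assoc[symmetric])
  have zpow: "z \<otimes> g' [^] i = g [^] i \<otimes> z" for i :: nat
  proof (induction i)
    case (Suc i)
    have "z \<otimes> g' [^] Suc i = (z \<otimes> g' [^] i) \<otimes> g'" using z G' by (simp add: m_assoc)
    also have "\<dots> = g [^] i \<otimes> (z \<otimes> g')" using z G G' by (simp only: Suc) (simp add: m_assoc)
    finally show ?case using z G by (simp add: zg m_assoc)
  qed (use z in simp)
  have "z \<otimes> \<one> \<sqsubset> z \<otimes> h'" using n(2) z by (simp add: zh z_def[symmetric])
  then have "\<one> \<sqsubset> h'" using left_iff[of z h' \<one>] z G' by simp
  then obtain k :: nat where k: "k \<ge> 1" "g' [^] k \<sqsubset> h' \<otimes> g' [^] k"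
    using recurrent[of g' h'] G' by blast
  have "z \<otimes> g' [^] k \<sqsubset> z \<otimes> (h' \<otimes> g' [^] k)"
    using k(2) left_iff[of z "h' \<otimes> g' [^] k" "g' [^] k"] z G' by simp
  moreover have "z \<otimes> (h' \<otimes> g' [^] k) = h \<otimes> (g [^] k \<otimes> z)"
  proof -
    have "z \<otimes> (h' \<otimes> g' [^] k) = (z \<otimes> h') \<otimes> g' [^] k" using z G' by (simp add: m_assoc)
    also have "\<dots> = h \<otimes> (z \<otimes> g' [^] k)" using z G G' by (simp only: zh) (simp add: m_assoc)
    finally show ?thesis by (simp add: zpow)
  qed
  moreover have "g [^] k \<otimes> z = g [^] (k + n) \<otimes> y"
    using G by (simp add: z_def m_assoc[symmetric] nat_pow_mult)
  ultimately show ?case using n k(1) by (intro exI[of _ "k + n"]) (auto simp: zpow)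
qed

text \<open>Otherwise \<open>a = s\<^sup>-\<^sup>1f\<^sup>2\<close> moves \<open>f\<^sup>-\<^sup>1y\<close> at least to \<open>y\<close>, while all its iterates stay below
  \<open>f\<^sup>jy\<close>. Then \<open>a\<^sup>2f\<^sup>-\<^sup>1\<close> moves \<open>ay\<close> up but moves the later points of the \<open>a\<close>-orbit down, against
  recurrence.\<close>

lemma no_crossing:
  fixes j :: nat
  assumes G: "y \<in> carrier G" "f \<in> carrier G" "s \<in> carrier G"
    and f: "y \<sqsubset> f \<otimes> y" and s: "s \<otimes> y \<sqsubseteq> f \<otimes> y"
  shows "s \<otimes> (f [^] j \<otimes> y) \<sqsubseteq> f [^] (j + 2) \<otimes> y"
proof (rule ccontr)
  assume neg: "\<not> ?thesis"
  define a where "a = inv s \<otimes> (f \<otimes> f)"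
  define e where "e = inv f \<otimes> y"
  define z where "z = f [^] j \<otimes> y"
  have C: "a \<in> carrier G" "e \<in> carrier G" "z \<in> carrier G" using G by (auto simp: a_def e_def z_def)
  note C = C G
  have fe: "f \<otimes> e = y" using G by (simp add: e_def m_assoc[symmetric])
  have "f \<otimes> e \<sqsubset> f \<otimes> y" using f fe by simp
  then have ey: "e \<sqsubset> y" using left_iff[of f y e] C by simp
  have "inv s \<otimes> (s \<otimes> y) \<sqsubseteq> inv s \<otimes> (f \<otimes> y)" using s C by - (rule left, auto)
  moreover have "a \<otimes> e = inv s \<otimes> (f \<otimes> (f \<otimes> e))" using C by (simp add: a_def m_assoc)
  ultimately have yae: "y \<sqsubseteq> a \<otimes> e" using C by (simp add: fe m_assoc[symmetric])
  have eae: "e \<sqsubset> a \<otimes> e" using ey yae trans[of y "a \<otimes> e" e] C by auto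
  \<comment> \<open>This is the negated conclusion, translated by \<open>inv s\<close>; it traps the
    \<open>a\<close>-orbit of \<open>e\<close> below \<open>z\<close>.\<close>
  have az: "a \<otimes> z \<sqsubseteq> z"
  proof -
    have "f [^] (j + 2) = f \<otimes> f \<otimes> f [^] j"
      using G nat_pow_mult[of f 2 j] by (simp add: add.commute numeral_2_eq_2)
    then have eq: "f [^] (j + 2) \<otimes> y = f \<otimes> f \<otimes> z" using C by (simp add: z_def m_assoc)
    have "f \<otimes> f \<otimes> z \<sqsubseteq> s \<otimes> z" using neg total[of "s \<otimes> z" "f \<otimes> f \<otimes> z"] C
      unfolding eq z_def[symmetric] by auto
    then have "inv s \<otimes> (f \<otimes> f \<otimes> z) \<sqsubseteq> inv s \<otimes> (s \<otimes> z)" using C by - (rule left, auto)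
    then show ?thesis using C by (simp add: a_def m_assoc[symmetric])
  qed
  define A where "A n = a [^] n \<otimes> e" for n :: nat
  have A: "A n \<in> carrier G" for n using C by (simp add: A_def)
  have A0: "A 0 = e" using C by (simp add: A_def)
  have ASuc: "A (Suc n) = a \<otimes> A n" for n
    using C nat_pow_Suc2[of a n] by (simp add: A_def m_assoc)
  have f_up: "f [^] i \<otimes> y \<sqsubset> f [^] Suc i \<otimes> y" for i :: nat
  proof -
    have "f [^] i \<otimes> y \<sqsubset> f [^] i \<otimes> (f \<otimes> y)" using f left_iff[of "f [^] i" "f \<otimes> y" y] C by simp
    then show ?thesis using C by (simp add: m_assoc)
  qed
  have y_le: "y \<sqsubseteq> f [^] i \<otimes> y" for i :: nat
  proof (induction i)
    case (Suc i)
    then show ?case using lt_imp_le[OF _ _ f_up[of i]] trans[of y "f [^] i \<otimes> y"] C by auto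
  qed (use C refl in simp)
  have Az: "A n \<sqsubseteq> z" for n
  proof (induction n)
    case 0
    show ?case using lt_imp_le[OF _ _ ey] y_le[of j] trans[of e y z] C by (auto simp: A0 z_def)
  next
    case (Suc n)
    have "a \<otimes> A n \<sqsubseteq> a \<otimes> z" using Suc left A C by auto
    then show ?case using az trans[of "a \<otimes> A n" "a \<otimes> z" z] A C by (simp add: ASuc)
  qed
  have A_step: "A n \<sqsubseteq> A (Suc n)" for n
  proof (induction n)
    case 0
    show ?case using lt_imp_le[OF _ _ eae] C by (simp add: ASuc A0)
  next
    case (Suc n)
    then show ?case using left[of a] A C by (simp add: ASuc)
  qed
  have A_mono: "A m \<sqsubseteq> A n" if "m \<le> n" for m n
    using that
  proof (induction n rule: dec_induct)
    case (step n)
    then show ?case using A_step[of n] trans[of "A m" "A n" "A (Suc n)"] A by simp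
  qed (use A refl in simp)
  \<comment> \<open>The orbit \<open>A\<close> eventually stays within one application of
    \<open>f\<close>: otherwise it would overtake every \<open>f [^] i \<otimes> e\<close>, and in
    particular climb above its bound \<open>z\<close>.\<close>
  have "\<exists>p. \<forall>m. A m \<sqsubseteq> f \<otimes> A p"
  proof (rule ccontr)
    assume "\<nexists>p. \<forall>m. A m \<sqsubseteq> f \<otimes> A p"
    then have ex: "\<exists>m. f \<otimes> A p \<sqsubseteq> A m" for p
      using total[OF m_closed[OF C(5) A] A] by blast
    have "\<exists>m. f [^] i \<otimes> e \<sqsubseteq> A m" for i :: nat
    proof (induction i)
      case 0
      show ?case using C refl by (intro exI[of _ 0]) (simp add: A0)
    next
      case (Suc i)
      then obtain m where m: "f [^] i \<otimes> e \<sqsubseteq> A m" by blast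
      obtain m' where m': "f \<otimes> A m \<sqsubseteq> A m'" using ex by blast
      have "f \<otimes> (f [^] i \<otimes> e) \<sqsubseteq> f \<otimes> A m" using m left A C by auto
      then have "f \<otimes> (f [^] i \<otimes> e) \<sqsubseteq> A m'" using m' trans[of _ "f \<otimes> A m"] A C by auto
      then show ?case using C nat_pow_Suc2[of f i] by (auto simp: m_assoc)
    qed
    then obtain m where "f [^] Suc (Suc j) \<otimes> e \<sqsubseteq> A m" by blast
    moreover have "f [^] Suc (Suc j) \<otimes> e = f [^] Suc j \<otimes> y"
      using C by (simp add: m_assoc fe)
    ultimately have "f [^] Suc j \<otimes> y \<sqsubseteq> z" using Az trans[of _ "A m" z] A C by auto
    then show False using f_up[of j] by (simp add: z_def)
  qed
  then obtain p where p: "\<And>m. A m \<sqsubseteq> f \<otimes> A p" by blast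
  define h where "h = a \<otimes> (a \<otimes> inv f)"
  have h_mult: "h \<otimes> x = a \<otimes> (a \<otimes> (inv f \<otimes> x))" if "x \<in> carrier G" for x
    using that C by (simp add: h_def m_assoc)
  have "A 1 \<sqsubset> h \<otimes> A 1"
  proof
    assume le: "h \<otimes> A 1 \<sqsubseteq> A 1"
    have "inv f \<otimes> y \<sqsubseteq> inv f \<otimes> (a \<otimes> e)" using yae C by - (rule left, auto)
    then have "e \<sqsubseteq> inv f \<otimes> A 1" by (simp add: e_def[symmetric] ASuc A0)
    then have "a \<otimes> (a \<otimes> e) \<sqsubseteq> h \<otimes> A 1" using A C by (auto simp: h_mult intro!: left)
    then have "a \<otimes> (a \<otimes> e) \<sqsubseteq> a \<otimes> e"
      using le trans[of _ "h \<otimes> A 1" "A 1"] A C by (auto simp: ASuc A0 h_def)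
    then show False using eae left_iff[of a "a \<otimes> e" e] C by simp
  qed
  moreover have "h \<in> carrier G" using C by (simp add: h_def)
  \<comment> \<open>The return must be this late so that \<open>n = Suc q\<close> with
    \<open>q \<ge> p\<close>: then \<open>inv f\<close> takes \<open>A (Suc n)\<close> down to
    \<open>A q\<close> or below, and the two factors \<open>a\<close> of \<open>h\<close> lead back
    only to \<open>A (q + 2)\<close>, which is \<open>A (Suc n)\<close>.\<close>
  ultimately obtain n where n: "n \<ge> Suc p" "a [^] n \<otimes> A 1 \<sqsubset> h \<otimes> (a [^] n \<otimes> A 1)"
    using recurrent_at[of "A 1" a h "Suc p"] A C by blast
  have an: "a [^] n \<otimes> A 1 = A (Suc n)"
    using C by (simp add: A_def m_assoc)
  obtain q where q: "n = Suc q" "q \<ge> p" using n(1) by (metis Suc_le_D Suc_le_mono)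
  have "f \<otimes> A p \<sqsubseteq> f \<otimes> A q" using A_mono[OF q(2)] left A C by auto
  then have "A (Suc n) \<sqsubseteq> f \<otimes> A q" using p[of "Suc n"] trans[of _ "f \<otimes> A p"] A C by auto
  then have "inv f \<otimes> A (Suc n) \<sqsubseteq> inv f \<otimes> (f \<otimes> A q)" using A C by - (rule left, auto)
  then have "inv f \<otimes> A (Suc n) \<sqsubseteq> A q" using A C by (simp add: m_assoc[symmetric])
  then have "h \<otimes> A (Suc n) \<sqsubseteq> a \<otimes> (a \<otimes> A q)" using A C by (auto simp: h_mult intro!: left)
  moreover have "A (Suc n) \<sqsubset> h \<otimes> A (Suc n)" using n(2) unfolding an .
  ultimately show False by (simp add: q(1) ASuc)
qed

text \<open>For \<open>n \<ge> 0\<close> this is \<open>no_crossing\<close> at the identity. For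
  \<open>n < 0\<close> it is \<open>no_crossing\<close> for the reversed relation, with
  \<open>inv f\<close> and \<open>inv s\<close> at the base point \<open>f\<close>. The constant 2
  is the same for all \<open>n\<close>.\<close>

lemma shift_bound:
  fixes n :: int
  assumes G: "f \<in> carrier G" "s \<in> carrier G" and f: "\<one> \<sqsubset> f" and s: "s \<sqsubseteq> f"
  shows "s \<otimes> f [^] n \<sqsubseteq> f [^] (n + 2)"
proof (cases "n \<ge> 0")
  case True
  then obtain j where j: "n = int j" using zero_le_imp_eq_int by blast
  have "s \<otimes> (f [^] j \<otimes> \<one>) \<sqsubseteq> f [^] (j + 2) \<otimes> \<one>"
    using G f s by (intro no_crossing) auto
  moreover have "f [^] (n + 2) = f [^] (j + 2)"
    unfolding j using int_pow_int[of G f "j + 2"] by (simp add: add.commute)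
  ultimately show ?thesis using G by (simp add: j int_pow_int)
next
  case False
  \<comment> \<open>Since \<open>inv f [^] i \<otimes> f\<close> is the power of \<open>f\<close>
    with exponent \<open>1 - i\<close>, this choice turns \<open>i = j + 2\<close> into
    \<open>n\<close> and \<open>i = j\<close> into \<open>n + 2\<close>.\<close>
  define j where "j = nat (- n - 1)"
  have n: "n = - int j - 1" using False by (simp add: j_def)
  interpret D: recurrent_left_preorder G "\<lambda>x y. y \<sqsubseteq> x" by (rule dual)
  have "inv s \<otimes> s \<sqsubseteq> inv s \<otimes> f" using G s by - (rule left, auto)
  then have "inv f [^] (j + 2) \<otimes> f \<sqsubseteq> inv s \<otimes> (inv f [^] j \<otimes> f)"
    using G f by (intro D.no_crossing) auto
  moreover have "inv f [^] i \<otimes> f = f [^] (1 - int i)" for i :: nat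
  proof -
    have "inv f [^] i = f [^] (- int i)"
      using G by (simp add: int_pow_neg_int nat_pow_inv)
    moreover have "f = f [^] (1::int)" using G by simp
    ultimately have "inv f [^] i \<otimes> f = f [^] (- int i) \<otimes> f [^] (1::int)" by simp
    also have "\<dots> = f [^] (- int i + 1)" using G by (simp only: int_pow_mult)
    finally show ?thesis by (simp add: algebra_simps)
  qed
  ultimately have "f [^] (1 - int (j + 2)) \<sqsubseteq> inv s \<otimes> f [^] (1 - int j)"
    by (simp only:)
  moreover have "1 - int (j + 2) = n" "1 - int j = n + 2" by (simp_all add: n)
  ultimately have "f [^] n \<sqsubseteq> inv s \<otimes> f [^] (n + 2)" by (simp only:)
  then have "s \<otimes> f [^] n \<sqsubseteq> s \<otimes> (inv s \<otimes> f [^] (n + 2))" using G by - (rule left, auto)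
  then show ?thesis using G by (simp add: m_assoc[symmetric])
qed

end

section \<open>Invariant means\<close>

lemma ell_infty_iff:
  "f \<in> ell_infty G \<longleftrightarrow> (\<exists>C. \<forall>x\<in>carrier G. \<bar>f x\<bar> \<le> C) \<and> (\<forall>x. x \<notin> carrier G \<longrightarrow> f x = 0)"
  by (auto simp: ell_infty_def bounded_real)

lemma ell_infty_add: "f \<in> ell_infty G \<Longrightarrow> g \<in> ell_infty G \<Longrightarrow> f + g \<in> ell_infty G"
  unfolding ell_infty_def using bounded_plus_comp[of f "carrier G" g] by (auto simp: image_image plus_fun_def)

lemma ell_infty_zero: "0 \<in> ell_infty G"
  by (auto simp: ell_infty_iff intro!: exI[of _ 0])

lemma ell_infty_minus: "f \<in> ell_infty G \<Longrightarrow> - f \<in> ell_infty G"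
  by (auto simp: ell_infty_iff)

lemma ell_infty_translate:
  fixes G :: "('a, 'b) monoid_scheme" (structure)
  assumes "group G" "g \<in> carrier G" "f \<in> ell_infty G"
  shows "translate G g f \<in> ell_infty G"
proof -
  interpret group G by fact
  show ?thesis using assms(2,3) by (fastforce simp: ell_infty_iff translate_def)
qed

lemma ell_infty_pos_indicator: "A \<subseteq> carrier G \<Longrightarrow> indicat_real A \<in> ell_infty_pos G"
  by (auto simp: ell_infty_pos_def ell_infty_iff le_fun_def indicator_def intro!: exI[of _ 1])

locale invariant_mean = group G for G :: "('a, 'b) monoid_scheme" (structure) +
  fixes m :: "('a \<Rightarrow> real) \<Rightarrow> real"
  assumes mean_add: "f \<in> ell_infty G \<Longrightarrow> f' \<in> ell_infty G \<Longrightarrow> m (f + f') = m f + m f'"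
    and mean_nonneg: "f \<in> ell_infty_pos G \<Longrightarrow> 0 \<le> m f"
    and mean_one: "m (indicat_real (carrier G)) = 1"
    and mean_translate: "g \<in> carrier G \<Longrightarrow> f \<in> ell_infty G \<Longrightarrow> m (translate G g f) = m f"
begin

lemma mean_zero: "m 0 = 0"
  using mean_add[OF ell_infty_zero ell_infty_zero] unfolding add_0 by linarith

lemma mean_mono:
  assumes "f \<in> ell_infty G" "g \<in> ell_infty G" "f \<le> g"
  shows "m f \<le> m g"
proof -
  have "g + - f \<in> ell_infty_pos G"
    using assms ell_infty_add[OF assms(2) ell_infty_minus[OF assms(1)]]
    by (auto simp: ell_infty_pos_def le_fun_def)
  then have "0 \<le> m (g + - f)" "g + - f \<in> ell_infty G"
    using mean_nonneg by (auto simp: ell_infty_pos_def)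
  moreover have "f + (g + - f) = g" by (simp add: fun_eq_iff)
  ultimately show ?thesis using mean_add[OF assms(1), of "g + - f"] by simp
qed

lemma mean_sum:
  assumes "finite I" "\<And>i. i \<in> I \<Longrightarrow> f i \<in> ell_infty G"
  shows "(\<Sum>i\<in>I. f i) \<in> ell_infty G \<and> m (\<Sum>i\<in>I. f i) = (\<Sum>i\<in>I. m (f i))"
  using assms
proof (induction)
  case empty
  show ?case using mean_zero ell_infty_zero by (simp add: zero_fun_def)
next
  case (insert i I)
  then show ?case
    by (simp only: sum.insert[OF insert.hyps(1,2)]) (simp only: mean_add ell_infty_add insertI1 insertI2)
qed

text \<open>The displacement of \<open>g \<otimes> h\<close> at \<open>x\<close> is that of
  \<open>g\<close> at \<open>h \<otimes> x\<close> plus that of \<open>h\<close> at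
  \<open>x\<close>, and the first summand is a translate of the displacement of \<open>g\<close>.
  \<open>K\<close> may be unbounded; only its displacements are averaged.\<close>

lemma drift_hom:
  fixes K :: "'a \<Rightarrow> real"
  assumes K: "\<And>g. g \<in> carrier G \<Longrightarrow> \<exists>C. \<forall>x\<in>carrier G. \<bar>K (g \<otimes> x) - K x\<bar> \<le> C"
  defines "\<tau> \<equiv> \<lambda>g. m (\<lambda>x. if x \<in> carrier G then K (g \<otimes> x) - K x else 0)"
  assumes g: "g \<in> carrier G" and h: "h \<in> carrier G"
  shows "\<tau> (g \<otimes> h) = \<tau> g + \<tau> h"
proof -
  define F where "F g x = (if x \<in> carrier G then K (g \<otimes> x) - K x else 0)" for g x
  have F: "F g \<in> ell_infty G" if "g \<in> carrier G" for g
    using K[OF that] by (auto simp: ell_infty_iff F_def)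
  have "F (g \<otimes> h) = translate G (inv h) (F g) + F h"
    using g h by (auto simp: F_def translate_def fun_eq_iff m_assoc)
  moreover have "translate G (inv h) (F g) \<in> ell_infty G"
    using ell_infty_translate[OF is_group _ F[OF g]] h by simp
  ultimately have "m (F (g \<otimes> h)) = m (F g) + m (F h)"
    using g h F by (simp add: mean_add mean_translate)
  then show ?thesis by (simp add: \<tau>_def F_def[abs_def])
qed

text \<open>\<open>B\<close> consists of the points of \<open>E\<close> that do not return within
  \<open>N\<close> steps. Its preimages under the powers 0 to \<open>N\<close> of \<open>g\<close>
  are disjoint and have equal mean, and together their mean is at most 1.\<close>

lemma poincare_recurrence:
  fixes N :: nat
  assumes E: "E \<subseteq> carrier G" and g: "g \<in> carrier G"
  defines "B \<equiv> {x \<in> E. \<forall>n\<in>{1..N}. g [^] n \<otimes> x \<notin> E}"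
  shows "m (indicat_real B) \<le> 1 / Suc N"
proof -
  have B: "B \<subseteq> carrier G" using E by (auto simp: B_def)
  define T where "T j = translate G (inv (g [^] j)) (indicat_real B)" for j :: nat
  have ind: "indicat_real A \<in> ell_infty G" if "A \<subseteq> carrier G" for A
    using ell_infty_pos_indicator[OF that] by (simp add: ell_infty_pos_def)
  have T: "T j \<in> ell_infty G" "m (T j) = m (indicat_real B)" for j
    using g ind[OF B] ell_infty_translate[OF is_group] by (auto simp: T_def mean_translate)
  have T_eq: "T j x = (if x \<in> carrier G \<and> g [^] j \<otimes> x \<in> B then 1 else 0)" for j x
    using g by (simp add: T_def translate_def indicator_def)
  have disj: "i = j" if "i \<le> N" "j \<le> N" "x \<in> carrier G" "g [^] i \<otimes> x \<in> B" "g [^] j \<otimes> x \<in> B"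
    for i j x
  proof -
    \<comment> \<open>A common point of two preimages would give a point of \<open>B\<close>
      returning to \<open>E\<close> after \<open>j - i\<close> steps.\<close>
    have lt: False if "i < j" "j \<le> N" "g [^] i \<otimes> x \<in> B" "g [^] j \<otimes> x \<in> B" for i j
    proof -
      have "g [^] (j - i) \<otimes> (g [^] i \<otimes> x) = g [^] j \<otimes> x"
        using g \<open>x \<in> carrier G\<close> that(1) by (simp add: m_assoc[symmetric] nat_pow_mult)
      moreover have "j - i \<in> {1..N}" using that by auto
      ultimately show False using that(3,4) unfolding B_def by force
    qed
    show ?thesis using lt[of i j] lt[of j i] that by (meson linorder_neqE_nat)
  qed
  have "(\<Sum>j\<le>N. T j) \<le> indicat_real (carrier G)"
  proof (rule le_funI)
    fix x
    have le: "(\<Sum>j\<le>N. T j x) \<le> indicat_real (carrier G) x"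
    proof (cases "\<exists>i\<le>N. x \<in> carrier G \<and> g [^] i \<otimes> x \<in> B")
      case True
      then obtain i where i: "i \<le> N" "x \<in> carrier G" "g [^] i \<otimes> x \<in> B" by blast
      have "(\<Sum>j\<le>N. T j x) = (\<Sum>j\<le>N. if j = i then 1 else 0)"
        using disj i by (intro sum.cong) (auto simp: T_eq)
      then show ?thesis using i by simp
    next
      case False
      then have "(\<Sum>j\<le>N. T j x) = 0" by (intro sum.neutral) (auto simp: T_eq)
      then show ?thesis by simp
    qed
    have "(\<Sum>j\<in>J. T j) x = (\<Sum>j\<in>J. T j x)" if "finite J" for J
      using that by induction auto
    then show "(\<Sum>j\<le>N. T j) x \<le> indicat_real (carrier G) x" using le by simp
  qed
  then have "m (\<Sum>j\<le>N. T j) \<le> 1"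
    using mean_mono[OF _ ind[OF order.refl], of "\<Sum>j\<le>N. T j"] mean_sum[of "{..N}" T] T mean_one by simp
  then have "real (Suc N) * m (indicat_real B) \<le> 1"
    using mean_sum[of "{..N}" T] T by simp
  then show ?thesis by (simp add: field_simps)
qed

end

section \<open>Trivial preorders\<close>

text \<open>Elements are products of words in finitely many letters. Countability lets a single
  subsequence settle all comparisons of pairs.\<close>

lemma (in group) countable_carrier:
  assumes "finitely_generated_group G"
  shows "countable (carrier G)"
proof -
  obtain S where S: "finite S" "S \<subseteq> carrier G" "generate G S = carrier G"
    using assms unfolding finitely_generated_group_def by auto
  define w where "w xs = foldr (\<otimes>) xs \<one>" for xs
  have w_closed: "w xs \<in> carrier G" if "set xs \<subseteq> carrier G" for xs
    using that by (induction xs) (auto simp: w_def)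
  have w_append: "w (xs @ ys) = w xs \<otimes> w ys" if "set xs \<subseteq> carrier G" "set ys \<subseteq> carrier G" for xs ys
    using that(1) by (induction xs) (use w_closed[OF that(2)] w_closed in \<open>auto simp: w_def m_assoc\<close>)
  define L where "L = lists (S \<union> m_inv G ` S)"
  have "x \<in> w ` L" if "x \<in> generate G S" for x
    using that
  proof induction
    case one
    show ?case by (auto simp: L_def w_def intro!: image_eqI[of _ _ "[]"])
  next
    case (incl h)
    then show ?case using S by (auto simp: L_def w_def intro!: image_eqI[of _ _ "[h]"])
  next
    case (inv h)
    then show ?case using S by (auto simp: L_def w_def intro!: image_eqI[of _ _ "[inv h]"])
  next
    case (eng x y)
    then obtain xs ys where xy: "xs \<in> L" "ys \<in> L" "x = w xs" "y = w ys" by auto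
    have "S \<union> m_inv G ` S \<subseteq> carrier G" using S(2) by auto
    then have "set xs \<subseteq> carrier G" "set ys \<subseteq> carrier G"
      using xy unfolding L_def in_lists_conv_set by blast+
    then show ?case using xy w_append by (intro image_eqI[of _ _ "xs @ ys"]) (auto simp: L_def)
  qed
  moreover have "countable L" using S(1) unfolding L_def by (intro countable_lists) (auto intro: countable_finite)
  ultimately show ?thesis using S(3) countable_subset[OF _ countable_image] by (metis subsetI)
qed

text \<open>At each stage, \<open>Q i\<close> or its negation holds infinitely often along the
  current sequence; pass to those indices and diagonalise.\<close>

lemma diagonal_decided:
  fixes Q :: "nat \<Rightarrow> nat \<Rightarrow> bool"
  obtains \<sigma> :: "nat \<Rightarrow> nat" where "strict_mono \<sigma>"
    "\<And>i. (\<forall>\<^sub>F k in sequentially. Q i (\<sigma> k)) \<or> (\<forall>\<^sub>F k in sequentially. \<not> Q i (\<sigma> k))"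
proof -
  define P where "P i s \<longleftrightarrow> (\<forall>k. Q i (s k)) \<or> (\<forall>k. \<not> Q i (s k))" for i :: nat and s :: "nat \<Rightarrow> nat"
  interpret subseqs P
  proof
    fix i and s :: "nat \<Rightarrow> nat"
    have "infinite {k. Q i (s k)} \<or> infinite {k. \<not> Q i (s k)}"
      using finite_Un[of "{k. Q i (s k)}" "{k. \<not> Q i (s k)}"] infinite_UNIV_nat
      by (metis Collect_neg_eq Compl_partition)
    then show "\<exists>r'. strict_mono r' \<and> P i (s \<circ> r')"
    proof
      assume "infinite {k. Q i (s k)}"
      then show ?thesis using strict_mono_enumerate enumerate_in_set unfolding P_def o_def by fastforce
    next
      assume "infinite {k. \<not> Q i (s k)}"
      then show ?thesis using strict_mono_enumerate enumerate_in_set unfolding P_def o_def by fastforce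
    qed
  qed
  \<comment> \<open>Only the tail of the diagonal beyond stage \<open>i\<close> is known to refine
    that stage, hence a conclusion that holds eventually.\<close>
  have "P i (diagseq \<circ> ((+) (Suc i)))" for i
    by (rule diagseq_holds) (auto simp: P_def)
  then have "(\<forall>k. Q i (diagseq (k + Suc i))) \<or> (\<forall>k. \<not> Q i (diagseq (k + Suc i)))" for i
    by (simp only: P_def o_def add.commute[of _ "Suc i"])
  then have "(\<forall>\<^sub>F k in sequentially. Q i (diagseq k)) \<or> (\<forall>\<^sub>F k in sequentially. \<not> Q i (diagseq k))" for i
    unfolding eventually_sequentially by (metis le_add_diff_inverse2)
  then show ?thesis using that subseq_diagseq by blast
qed

section \<open>Largest elements and a triviality criterion for left preorders\<close>

context left_preorder
begin

lemma exists_max: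
  assumes "finite T" "T \<noteq> {}" "T \<subseteq> carrier G"
  shows "\<exists>f\<in>T. \<forall>s\<in>T. s \<sqsubseteq> f"
  using assms
proof (induction rule: finite_ne_induct)
  case (singleton x)
  then show ?case using refl by simp
next
  case (insert x T)
  then obtain f where f: "f \<in> T" "\<forall>s\<in>T. s \<sqsubseteq> f" by auto
  have fx: "f \<in> carrier G" "x \<in> carrier G" using f insert by auto
  show ?case
  proof (cases "x \<sqsubseteq> f")
    case True
    then show ?thesis using f by blast
  next
    case False
    then have "f \<sqsubseteq> x" using total fx by blast
    then have "s \<sqsubseteq> x" if "s \<in> T" for s
      using f that trans[of s f x] fx insert.prems by auto
    then show ?thesis using refl fx by auto
  qed
qed

text \<open>The elements that do not move \<open>z\<close> up are closed under products, so
  \<open>z\<close> is a greatest element. Left translation carries any \<open>y\<close> to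
  \<open>z\<close>, so every \<open>y\<close> is greatest.\<close>

lemma trivial_if_generators_nonpos:
  assumes S: "S \<subseteq> carrier G" "generate G S = carrier G" and z: "z \<in> carrier G"
    and le: "\<And>s. s \<in> S \<Longrightarrow> s \<otimes> z \<sqsubseteq> z" "\<And>s. s \<in> S \<Longrightarrow> inv s \<otimes> z \<sqsubseteq> z"
    and xy: "x \<in> carrier G" "y \<in> carrier G"
  shows "x \<sqsubseteq> y"
proof -
  have z_max: "g \<otimes> z \<sqsubseteq> z" if "g \<in> carrier G" for g
  proof -
    have "g \<in> generate G S" using S that by simp
    then show ?thesis
    proof induction
      case (eng a b)
      then have ab: "a \<in> carrier G" "b \<in> carrier G" using S by auto
      have "a \<otimes> (b \<otimes> z) \<sqsubseteq> a \<otimes> z" using eng ab z by (simp add: left)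
      then show ?case using trans[of "a \<otimes> (b \<otimes> z)" "a \<otimes> z" z] eng ab z by (simp add: m_assoc)
    qed (use le z refl in auto)
  qed
  define g where "g = z \<otimes> inv y"
  have "g \<otimes> x \<otimes> inv z \<otimes> z \<sqsubseteq> z" using xy z by (intro z_max) (auto simp: g_def)
  moreover have "g \<otimes> x \<otimes> inv z \<otimes> z = g \<otimes> x" "g \<otimes> y = z"
    using xy z by (simp_all add: g_def m_assoc)
  ultimately have "g \<otimes> x \<sqsubseteq> g \<otimes> y" by simp
  then show ?thesis using left_iff[of g x y] xy z by (simp add: g_def)
qed

end

section \<open>Recurrent preorders on groups with an invariant mean\<close>

locale recurrent_left_preorder_mean = recurrent_left_preorder + invariant_mean
begin

text \<open>The orbit of the largest generator \<open>f\<close> cuts the group into intervals; by the shift bound, left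
  translation moves the number of the interval by a bounded amount, and \<open>f\<close> moves it by exactly one. So
  the mean displacement is a homomorphism with value one at \<open>f\<close>.\<close>

lemma generators_nonpos:
  assumes fg: "finitely_generated_group G" and epi: "epi G integer_group = {}"
    and S: "finite S" "S \<subseteq> carrier G" "generate G S = carrier G"
    and t: "t \<in> S \<union> m_inv G ` S"
  shows "t \<sqsubseteq> \<one>"
proof (rule ccontr)
  assume t1: "\<not> ?thesis"
  define T where "T = S \<union> m_inv G ` S"
  have TG: "T \<subseteq> carrier G" using S(2) by (auto simp: T_def)
  have "finite T" "T \<noteq> {}" using t S(1) by (auto simp: T_def)
  then have "\<exists>f\<in>T. \<forall>s\<in>T. s \<sqsubseteq> f" by (rule exists_max[OF _ _ TG])
  then obtain f where "f \<in> T" and fmax: "\<And>s. s \<in> T \<Longrightarrow> s \<sqsubseteq> f" by blast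
  then have f: "f \<in> carrier G" using TG by auto
  have tG: "t \<in> carrier G" using t TG by (auto simp: T_def)
  have f1: "\<one> \<sqsubset> f"
    using t1 fmax[of t] t trans[of t f \<one>] f tG by (auto simp: T_def)
  define p where "p n = f [^] n" for n :: int
  have p: "p n \<in> carrier G" for n using f by (simp add: p_def)
  have fp: "f \<otimes> p n = p (n + 1)" for n
    using int_pow_mult[OF f, of 1 n] f by (simp add: p_def add.commute)
  have p_up: "p n \<sqsubset> p (n + 1)" for n
    using left_iff[of "p n" f \<one>] f1 p f int_pow_mult[OF f, of n 1] by (simp add: p_def)
  have p_add: "p i \<sqsubseteq> p (i + int n)" for i n
  proof (induction n)
    case (Suc n)
    then show ?case
      using trans[OF p p p Suc lt_imp_le[OF p p p_up[of "i + int n"]]] by (simp add: add_ac)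
  qed (use p refl in simp)
  have p_mono: "p i \<sqsubseteq> p j" if "i \<le> j" for i j
    using p_add[of i "nat (j - i)"] that by simp
  have p_le: "i \<le> j" if "p i \<sqsubseteq> p j" for i j
  proof (rule ccontr)
    assume "\<not> i \<le> j"
    then have "p (j + 1) \<sqsubseteq> p j" using p_mono[of "j + 1" i] trans[OF p p p _ that] by simp
    then show False using p_up by blast
  qed
  \<comment> \<open>Generators and their inverses shift the orbit by at most 2, and bounds add up
    along products.\<close>
  have shift: "\<exists>C. \<forall>n. g \<otimes> p n \<sqsubseteq> p (n + C)" if "g \<in> carrier G" for g
  proof -
    have T2: "\<forall>n. s \<otimes> p n \<sqsubseteq> p (n + 2)" if "s \<in> T" for s
      using shift_bound[OF f _ f1 fmax[OF that]] that TG by (auto simp: p_def)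
    have "g \<in> generate G S" using that S by simp
    then show ?thesis
    proof induction
      case one
      show ?case using p refl by (intro exI[of _ 0]) simp
    next
      case (incl s)
      then have "\<forall>n. s \<otimes> p n \<sqsubseteq> p (n + 2)" by (intro T2) (simp add: T_def)
      then show ?case by (rule exI)
    next
      case (inv s)
      then have "\<forall>n. inv s \<otimes> p n \<sqsubseteq> p (n + 2)" by (intro T2) (simp add: T_def)
      then show ?case by (rule exI)
    next
      case (eng a b)
      then have ab: "a \<in> carrier G" "b \<in> carrier G" using S by auto
      obtain C D where C: "\<And>n. a \<otimes> p n \<sqsubseteq> p (n + C)" and D: "\<And>n. b \<otimes> p n \<sqsubseteq> p (n + D)"
        using eng.IH by blast
      have "a \<otimes> b \<otimes> p n \<sqsubseteq> p (n + (D + C))" for n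
      proof -
        have "a \<otimes> (b \<otimes> p n) \<sqsubseteq> a \<otimes> p (n + D)" using left[OF ab(1) _ p D[of n]] ab p by simp
        then have "a \<otimes> (b \<otimes> p n) \<sqsubseteq> p (n + D + C)"
          using trans[OF _ _ _ _ C[of "n + D"]] ab p by simp
        then show ?thesis using ab p by (simp add: m_assoc add.assoc)
      qed
      then show ?case by blast
    qed
  qed
  \<comment> \<open>The shift bounds for \<open>inv x\<close> and \<open>x\<close>, applied at the
    identity or a point moved near it, trap \<open>x\<close> between two orbit points; the least
    upper index then locates its interval.\<close>
  have "\<exists>n. p n \<sqsubseteq> x \<and> x \<sqsubset> p (n + 1)" if x: "x \<in> carrier G" for x
  proof -
    have p0: "p 0 = \<one>" by (simp add: p_def)
    obtain C where C: "\<And>n. x \<otimes> p n \<sqsubseteq> p (n + C)" using shift[OF x] by blast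
    obtain D where D: "\<And>n. inv x \<otimes> p n \<sqsubseteq> p (n + D)" using shift[of "inv x"] x by auto
    have "x \<otimes> (inv x \<otimes> p (- D)) \<sqsubseteq> x \<otimes> p 0" using D[of "- D"] x p by (intro left) auto
    then have lower: "p (- D) \<sqsubseteq> x" using x p by (simp add: m_assoc[symmetric] p0)
    have upper: "x \<sqsubseteq> p C" using C[of 0] x by (simp add: p0)
    have "- D \<le> C" using p_le[OF trans[OF p x p lower upper]] .
    have "x \<sqsubset> p (- D + int (nat (C + 1 + D)))"
    proof
      assume "p (- D + int (nat (C + 1 + D))) \<sqsubseteq> x"
      then have "p (C + 1) \<sqsubseteq> p C"
        using \<open>- D \<le> C\<close> trans[OF p x p _ upper] by simp
      then show False using p_up by blast
    qed
    then obtain k where k: "\<forall>i<k. \<not> x \<sqsubset> p (- D + int i)" "x \<sqsubset> p (- D + int k)"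
      using ex_least_nat_le[of "\<lambda>k. x \<sqsubset> p (- D + int k)"] by blast
    have "k \<noteq> 0" by (rule notI) (use k(2) lower in simp)
    then obtain j where "k = Suc j" using not0_implies_Suc by blast
    then show ?thesis using k by (intro exI[of _ "- D + int j"]) (auto simp: add_ac)
  qed
  then obtain K where K: "\<And>x. x \<in> carrier G \<Longrightarrow> p (K x) \<sqsubseteq> x" "\<And>x. x \<in> carrier G \<Longrightarrow> x \<sqsubset> p (K x + 1)"
    by metis
  have K_le: "K x \<le> j" if "x \<in> carrier G" "x \<sqsubset> p (j + 1)" for x j
  proof (rule ccontr)
    assume "\<not> K x \<le> j"
    then have "p (j + 1) \<sqsubseteq> x" using p_mono[of "j + 1" "K x"] trans[OF p p _ _ K(1)] that by simp
    then show False using that by blast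
  qed
  have le_K: "j \<le> K x" if "x \<in> carrier G" "p j \<sqsubseteq> x" for x j
  proof (rule ccontr)
    assume "\<not> j \<le> K x"
    then have "p (K x + 1) \<sqsubseteq> x" using p_mono[of "K x + 1" j] trans[OF p p _ _ that(2)] that by simp
    then show False using that K(2) by blast
  qed
  have K_f: "K (f \<otimes> x) = K x + 1" if x: "x \<in> carrier G" for x
  proof (rule antisym)
    have "f \<otimes> x \<sqsubset> f \<otimes> p (K x + 1)" using left_iff[OF f p x] K(2)[OF x] by blast
    then show "K (f \<otimes> x) \<le> K x + 1" using K_le f x by (simp add: fp)
    have "f \<otimes> p (K x) \<sqsubseteq> f \<otimes> x" using left[OF f p x] K(1)[OF x] by blast
    then show "K x + 1 \<le> K (f \<otimes> x)" using le_K f x by (simp add: fp)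
  qed
  \<comment> \<open>An upper bound suffices: the one for \<open>inv g\<close> at
    \<open>g \<otimes> x\<close> is a lower bound for \<open>g\<close> at \<open>x\<close>.\<close>
  have upper: "\<exists>C. \<forall>x\<in>carrier G. K (g \<otimes> x) \<le> K x + C" if g: "g \<in> carrier G" for g
  proof -
    obtain C where C: "\<And>n. g \<otimes> p n \<sqsubseteq> p (n + C)" using shift[OF g] by blast
    have "K (g \<otimes> x) \<le> K x + (1 + C)" if x: "x \<in> carrier G" for x
    proof -
      have "g \<otimes> x \<sqsubseteq> g \<otimes> p (K x + 1)" using left[OF g x p] lt_imp_le[OF x p K(2)[OF x]] by blast
      then have "g \<otimes> x \<sqsubseteq> p (K x + 1 + C)" using trans[OF _ _ p _ C] g x p by blast
      then have "p (K (g \<otimes> x)) \<sqsubseteq> p (K x + 1 + C)" using trans[OF p _ p K(1)] g x by blast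
      then show ?thesis using p_le by fastforce
    qed
    then show ?thesis by blast
  qed
  define R where "R x = real_of_int (K x)" for x
  have bound: "\<exists>C. \<forall>x\<in>carrier G. \<bar>R (g \<otimes> x) - R x\<bar> \<le> C" if g: "g \<in> carrier G" for g
  proof -
    obtain C where C: "\<And>x. x \<in> carrier G \<Longrightarrow> K (g \<otimes> x) \<le> K x + C" using upper[OF g] by blast
    obtain D where D: "\<And>x. x \<in> carrier G \<Longrightarrow> K (inv g \<otimes> x) \<le> K x + D" using upper[of "inv g"] g by auto
    have "\<bar>K (g \<otimes> x) - K x\<bar> \<le> max C D" if x: "x \<in> carrier G" for x
      using C[OF x] D[of "g \<otimes> x"] g x by (simp add: m_assoc[symmetric] abs_le_iff) linarith
    then have "\<bar>R (g \<otimes> x) - R x\<bar> \<le> real_of_int (max C D)" if "x \<in> carrier G" for x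
      using that unfolding R_def by (metis of_int_abs of_int_diff of_int_le_iff)
    then show ?thesis by blast
  qed
  define \<tau> where "\<tau> g = m (\<lambda>x. if x \<in> carrier G then R (g \<otimes> x) - R x else 0)" for g
  have "\<tau> f = 0"
    using real_hom_trivial[OF fg epi _ f, of \<tau>] drift_hom[of R, OF bound] unfolding \<tau>_def by blast
  moreover have "(\<lambda>x. if x \<in> carrier G then R (f \<otimes> x) - R x else 0) = indicat_real (carrier G)"
    by (auto simp: fun_eq_iff R_def K_f)
  ultimately show False by (simp add: \<tau>_def mean_one)
qed

end

section \<open>Reduction of arbitrary preorders to recurrent ones\<close>

locale left_preorder_mean = left_preorder + invariant_mean
begin

text \<open>For the pair \<open>p i = (g, h)\<close>, the points moved up by \<open>h\<close> that
  do not return to this set under \<open>g\<close> within \<open>2 ^ (i + 2)\<close> steps have mean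
  at most \<open>(1/2) ^ (i + 2)\<close>. These means sum to less than 1, so the bad sets cannot
  cover the group. The time limit depends on \<open>i\<close> but not on \<open>k\<close>, which
  lets it survive a limit in \<open>k\<close>.\<close>

lemma exists_nearly_recurrent_point:
  fixes k :: nat
  assumes p: "\<And>i. p i \<in> carrier G \<times> carrier G"
  shows "\<exists>z\<in>carrier G. \<forall>i<k. z \<sqsubset> snd (p i) \<otimes> z \<longrightarrow>
    (\<exists>n\<in>{1..2 ^ (i + 2)}. fst (p i) [^] (n::nat) \<otimes> z \<sqsubset> snd (p i) \<otimes> (fst (p i) [^] n \<otimes> z))"
proof (rule ccontr)
  assume neg: "\<not> ?thesis"
  define E where "E i = {z \<in> carrier G. z \<sqsubset> snd (p i) \<otimes> z}" for i
  define B where "B i = {z \<in> E i. \<forall>n\<in>{1..2 ^ (i + 2)}. fst (p i) [^] (n::nat) \<otimes> z \<notin> E i}" for i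
  have pG: "fst (p i) \<in> carrier G" for i using p[of i] by auto
  have BG: "B i \<subseteq> carrier G" for i by (auto simp: B_def E_def)
  have ind: "indicat_real A \<in> ell_infty G" if "A \<subseteq> carrier G" for A
    using ell_infty_pos_indicator[OF that] by (simp add: ell_infty_pos_def)
  have cover: "\<exists>i<k. z \<in> B i" if "z \<in> carrier G" for z
    using neg that pG unfolding B_def E_def by auto
  have sum_app: "(\<Sum>j\<in>J. T j) x = (\<Sum>j\<in>J. T j x)" if "finite J" for J x and T :: "nat \<Rightarrow> 'a \<Rightarrow> real"
    using that by induction auto
  have "indicat_real (carrier G) \<le> (\<Sum>i<k. indicat_real (B i))"
  proof (rule le_funI)
    fix x
    show "indicat_real (carrier G) x \<le> (\<Sum>i<k. indicat_real (B i)) x"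
    proof (cases "x \<in> carrier G")
      case True
      then obtain i where "i < k" "x \<in> B i" using cover by blast
      then have "1 \<le> (\<Sum>i<k. indicat_real (B i) x)"
        using member_le_sum[of i "{..<k}" "\<lambda>i. indicat_real (B i) x"] by simp
      then show ?thesis using True by (simp add: sum_app)
    qed (simp add: sum_app sum_nonneg)
  qed
  then have "1 \<le> (\<Sum>i<k. m (indicat_real (B i)))"
    using mean_mono[OF ind[OF order.refl]] mean_sum[of "{..<k}" "\<lambda>i. indicat_real (B i)"] ind[OF BG] mean_one
    by (metis finite_lessThan)
  also have "\<dots> \<le> (\<Sum>i<k. (1/2) ^ (i + 2))"
  proof (rule sum_mono)
    fix i
    have "m (indicat_real (B i)) \<le> 1 / Suc (2 ^ (i + 2))"
      unfolding B_def by (rule poincare_recurrence) (auto simp: pG E_def)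
    also have "\<dots> \<le> 1 / 2 ^ (i + 2)" by (rule frac_le) auto
    finally show "m (indicat_real (B i)) \<le> (1/2) ^ (i + 2)" by (simp add: power_divide)
  qed
  also have "\<dots> = 1/2 - (1/2) ^ (k + 1)" by (induction k) auto
  also have "\<dots> < 1" using zero_less_power[of "1/2::real" "k + 1"] by linarith
  finally show False by simp
qed

text \<open>The limit preorder is recurrent, so all generators and inverses are nonpositive for it.
  As they are finitely many, one term of the sequence already witnesses this for the original
  preorder, which is then trivial.\<close>

theorem trivial_if_no_epi:
  assumes fg: "finitely_generated_group G" and epi: "epi G integer_group = {}"
    and xy: "x \<in> carrier G" "y \<in> carrier G"
  shows "x \<sqsubseteq> y"
proof (rule ccontr)
  assume nontrivial: "\<not> ?thesis"
  obtain S where S: "finite S" "S \<subseteq> carrier G" "generate G S = carrier G"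
    using fg unfolding finitely_generated_group_def by auto
  define T where "T = S \<union> m_inv G ` S"
  have T: "finite T" "T \<subseteq> carrier G" using S by (auto simp: T_def)
  define p where "p = from_nat_into (carrier G \<times> carrier G)"
  have ne: "carrier G \<times> carrier G \<noteq> {}" by auto
  have p: "p i \<in> carrier G \<times> carrier G" for i
    unfolding p_def by (rule from_nat_into[OF ne])
  have p_surj: "\<exists>i. p i = (g, h)" if "g \<in> carrier G" "h \<in> carrier G" for g h
    using from_nat_into_surj[of "carrier G \<times> carrier G" "(g, h)"] countable_carrier[OF fg] that
    by (auto simp: p_def)
  have "\<forall>k. \<exists>z. z \<in> carrier G \<and> (\<forall>i<k. z \<sqsubset> snd (p i) \<otimes> z \<longrightarrow>
    (\<exists>n\<in>{1..2 ^ (i + 2)}. fst (p i) [^] (n::nat) \<otimes> z \<sqsubset> snd (p i) \<otimes> (fst (p i) [^] n \<otimes> z)))"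
    using exists_nearly_recurrent_point[of p, OF p] unfolding Bex_def by (rule allI)
  from choice[OF this] obtain z where zG: "\<And>k. z k \<in> carrier G"
    and z: "\<And>k i. i < k \<Longrightarrow> z k \<sqsubset> snd (p i) \<otimes> z k \<Longrightarrow>
      \<exists>n\<in>{1..2 ^ (i + 2)}. fst (p i) [^] (n::nat) \<otimes> z k \<sqsubset> snd (p i) \<otimes> (fst (p i) [^] n \<otimes> z k)"
    by blast
  obtain \<sigma> where \<sigma>: "strict_mono \<sigma>"
    and dec: "\<And>i. (\<forall>\<^sub>F k in sequentially. fst (p i) \<otimes> z (\<sigma> k) \<sqsubseteq> snd (p i) \<otimes> z (\<sigma> k)) \<or>
      (\<forall>\<^sub>F k in sequentially. \<not> fst (p i) \<otimes> z (\<sigma> k) \<sqsubseteq> snd (p i) \<otimes> z (\<sigma> k))"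
    using diagonal_decided[of "\<lambda>i k. fst (p i) \<otimes> z k \<sqsubseteq> snd (p i) \<otimes> z k"] by blast
  define w where "w k = z (\<sigma> k)" for k
  have wG: "w k \<in> carrier G" for k using zG by (simp add: w_def)
  \<comment> \<open>The limit of the right translates of the preorder by \<open>w k\<close>. Right
    translation preserves left invariance, and the choice of \<open>\<sigma>\<close> makes every
    comparison eventually constant, which gives totality.\<close>
  define le' where "le' g h \<longleftrightarrow> (\<forall>\<^sub>F k in sequentially. g \<otimes> w k \<sqsubseteq> h \<otimes> w k)" for g h
  have not_le': "\<forall>\<^sub>F k in sequentially. h \<otimes> w k \<sqsubset> g \<otimes> w k"
    if "g \<in> carrier G" "h \<in> carrier G" "\<not> le' g h" for g h
  proof -
    note gh = that
    obtain i where i: "p i = (g, h)" using p_surj[OF gh(1,2)] by blast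
    show ?thesis using dec[of i] gh(3) by (simp add: i le'_def w_def)
  qed
  have le'_total: "le' g h \<or> le' h g" if "g \<in> carrier G" "h \<in> carrier G" for g h
  proof (cases "le' g h")
    case False
    from not_le'[OF that this] have "le' h g"
      unfolding le'_def by eventually_elim (use that wG lt_imp_le in auto)
    then show ?thesis ..
  qed simp
  interpret L: left_preorder G le'
  proof unfold_locales
    fix a b c assume abc: "a \<in> carrier G" "b \<in> carrier G" "c \<in> carrier G"
    show "le' a b \<or> le' b a" using le'_total abc by blast
    show "le' a c" if "le' a b" "le' b c"
      using that unfolding le'_def by eventually_elim (use trans abc wG in blast)
    show "le' (a \<otimes> b) (a \<otimes> c)" if "le' b c"
      using that unfolding le'_def by eventually_elim (use left abc wG in \<open>simp add: m_assoc\<close>)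
  qed
  interpret L: recurrent_left_preorder_mean G le' m
  proof unfold_locales
    fix g h assume gh: "g \<in> carrier G" "h \<in> carrier G" and "\<not> le' h \<one>"
    then have pos: "\<forall>\<^sub>F k in sequentially. w k \<sqsubset> h \<otimes> w k"
      using not_le'[of h \<one>] wG by simp
    obtain i where i: "p i = (g, h)" using p_surj gh by blast
    show "\<exists>n::nat. n \<ge> 1 \<and> \<not> le' (h \<otimes> g [^] n) (g [^] n)"
    proof (rule ccontr)
      assume "\<not> ?thesis"
      \<comment> \<open>The range of \<open>n\<close> is finite and independent of \<open>k\<close>,
        so the eventual statements can be combined, contradicting near recurrence at
        \<open>w k\<close>.\<close>
      then have "\<forall>n\<in>{1..2 ^ (i + 2)::nat}. \<forall>\<^sub>F k in sequentially. h \<otimes> g [^] n \<otimes> w k \<sqsubseteq> g [^] n \<otimes> w k"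
        unfolding le'_def by auto
      then have "\<forall>\<^sub>F k in sequentially. \<forall>n\<in>{1..2 ^ (i + 2)::nat}. h \<otimes> g [^] n \<otimes> w k \<sqsubseteq> g [^] n \<otimes> w k"
        by (intro eventually_ball_finite) auto
      moreover have "\<forall>\<^sub>F k in sequentially. i < k" by (rule eventually_gt_at_top)
      ultimately have "\<forall>\<^sub>F k in sequentially. False"
        using pos
      proof eventually_elim
        case (elim k)
        have "i < \<sigma> k" using elim(2) strict_mono_imp_increasing[OF \<sigma>, of k] by linarith
        then obtain n :: nat where "n \<in> {1..2 ^ (i + 2)}" "g [^] n \<otimes> w k \<sqsubset> h \<otimes> (g [^] n \<otimes> w k)"
          using z[of i "\<sigma> k"] elim(3) i by (auto simp: w_def)
        then show ?case using elim(1) gh wG by (simp add: m_assoc)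
      qed
      then show False by simp
    qed
  qed
  have "le' t \<one>" if "t \<in> T" for t
    using L.generators_nonpos[OF fg epi S] that by (simp add: T_def)
  then have "\<forall>t\<in>T. \<forall>\<^sub>F k in sequentially. t \<otimes> w k \<sqsubseteq> w k"
    using wG by (simp add: le'_def)
  then have "\<forall>\<^sub>F k in sequentially. \<forall>t\<in>T. t \<otimes> w k \<sqsubseteq> w k"
    using T(1) by (intro eventually_ball_finite) auto
  then obtain k where "\<forall>t\<in>T. t \<otimes> w k \<sqsubseteq> w k"
    using eventually_happens'[OF sequentially_bot] by blast
  then show False
    using trivial_if_generators_nonpos[OF S(2,3) wG[of k] _ _ xy] nontrivial unfolding T_def by blast
qed

end

section \<open>Vector pricings\<close>

lemma ell_infty_pos_zero: "0 \<in> ell_infty_pos G"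
  by (simp add: ell_infty_pos_def ell_infty_zero)

lemma ell_infty_pos_add: "u \<in> ell_infty_pos G \<Longrightarrow> v \<in> ell_infty_pos G \<Longrightarrow> u + v \<in> ell_infty_pos G"
  using ell_infty_add[of u G v] by (auto simp: ell_infty_pos_def le_fun_def)

lemma translate_add: "translate G g (u + v) = translate G g u + translate G g v"
  by (auto simp: translate_def fun_eq_iff)

context group
begin

lemma ell_infty_pos_translate:
  "g \<in> carrier G \<Longrightarrow> u \<in> ell_infty_pos G \<Longrightarrow> translate G g u \<in> ell_infty_pos G"
  using ell_infty_translate[OF is_group, of g u]
  by (auto simp: ell_infty_pos_def le_fun_def translate_def)

lemma translate_translate:
  "g \<in> carrier G \<Longrightarrow> h \<in> carrier G \<Longrightarrow> translate G g (translate G h u) = translate G (g \<otimes> h) u"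
  by (auto simp: translate_def fun_eq_iff inv_mult_group m_assoc)

lemma translate_one: "u \<in> ell_infty G \<Longrightarrow> translate G \<one> u = u"
  by (auto simp: translate_def fun_eq_iff ell_infty_def)

lemma translate_eq_zero_iff:
  assumes "g \<in> carrier G" "u \<in> ell_infty G"
  shows "translate G g u = 0 \<longleftrightarrow> u = 0"
proof
  assume "translate G g u = 0"
  then have "translate G (inv g) (translate G g u) = 0"
    by (auto simp: translate_def fun_eq_iff)
  then show "u = 0" using assms by (simp add: translate_translate translate_one)
qed (auto simp: translate_def fun_eq_iff)

lemma translate_indicator_carrier:
  "g \<in> carrier G \<Longrightarrow> translate G g (indicat_real (carrier G)) = indicat_real (carrier G)"
  by (auto simp: translate_def fun_eq_iff)

end

locale equivariant_vector_pricing = group G for G :: "('a, 'b) monoid_scheme" (structure) +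
  fixes r :: "('a \<Rightarrow> real) \<Rightarrow> ('a \<Rightarrow> real) \<Rightarrow> ennreal"
  assumes vp: "vector_pricing G r" and equivariant: "vp_equivariant G r"
begin

abbreviation V where "V \<equiv> ell_infty_pos G"

lemma add: "u \<in> V \<Longrightarrow> v \<in> V \<Longrightarrow> w \<in> V \<Longrightarrow> w \<noteq> 0 \<Longrightarrow> r (u + v) w = r u w + r v w"
  and mult: "u \<in> V \<Longrightarrow> v \<in> V \<Longrightarrow> w \<in> V \<Longrightarrow> mult_defined (r u v) (r v w) \<Longrightarrow> r u w = r u v * r v w"
  and self: "u \<in> V \<Longrightarrow> r u u = 1"
  using vp unfolding vector_pricing_def by blast+

lemma translate_both:
  "g \<in> carrier G \<Longrightarrow> u \<in> V \<Longrightarrow> v \<in> V \<Longrightarrow> r (translate G g u) (translate G g v) = r u v"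
  using equivariant unfolding vp_equivariant_def by blast

lemma zero_left:
  assumes "w \<in> V" "w \<noteq> 0"
  shows "r 0 w = 0"
proof -
  have "r (0 + w) w = r 0 w + r w w"
    by (rule add) (use assms ell_infty_pos_zero in auto)
  then have "r 0 w + 1 = 0 + 1"
    unfolding add_0 using self[OF assms(1)] by simp
  then show ?thesis by (simp add: ennreal_add_left_cancel add.commute)
qed

text \<open>If both prices were infinite, their product would be defined and infinite, yet it would
  equal \<open>r u u = 1\<close>.\<close>

lemma price_cases: "u \<in> V \<Longrightarrow> v \<in> V \<Longrightarrow> r u v \<noteq> \<infinity> \<or> r v u \<noteq> \<infinity>"
  using mult[of u v u] self[of u] by (auto simp: mult_defined_def)

lemma price_finite_trans:
  "u \<in> V \<Longrightarrow> v \<in> V \<Longrightarrow> w \<in> V \<Longrightarrow> r u v \<noteq> \<infinity> \<Longrightarrow> r v w \<noteq> \<infinity> \<Longrightarrow> r u w \<noteq> \<infinity>"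
  using mult[of u v w] by (auto simp: mult_defined_def ennreal_mult_eq_top_iff)

section \<open>The invariant mean given by prices relative to the constant function one\<close>

abbreviation one_fun where "one_fun \<equiv> indicat_real (carrier G)"

lemma one_fun: "one_fun \<in> V" "one_fun \<noteq> 0"
  using ell_infty_pos_indicator[of "carrier G" G] one_closed
  by (auto simp: fun_eq_iff indicator_def)

text \<open>A bounded \<open>u\<close> lies below an integer multiple \<open>c n\<close> of
  \<open>one_fun\<close>, whose price is \<open>n\<close> by additivity alone; writing
  \<open>c n\<close> as \<open>u + v\<close> bounds the price of \<open>u\<close>.\<close>

lemma price_one_finite:
  assumes "u \<in> V"
  shows "r u one_fun \<noteq> \<infinity>"
proof -
  obtain C where C: "\<forall>x\<in>carrier G. \<bar>u x\<bar> \<le> C" "\<forall>x. x \<notin> carrier G \<longrightarrow> u x = 0"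
    using assms by (auto simp: ell_infty_pos_def ell_infty_iff)
  obtain n :: nat where n: "C \<le> real n" using real_arch_simple by blast
  define c where "c k x = real k * indicat_real (carrier G) x" for k x
  have cV: "c k \<in> V" for k
    by (auto simp: c_def ell_infty_pos_def ell_infty_iff le_fun_def indicator_def intro!: exI[of _ "real k"])
  have c: "r (c k) one_fun = of_nat k" for k
  proof (induction k)
    case 0
    have "c 0 = 0" by (auto simp: c_def fun_eq_iff)
    then show ?case using zero_left[OF one_fun] by (simp only: of_nat_0)
  next
    case (Suc k)
    have "c (Suc k) = c k + one_fun" by (auto simp: c_def fun_eq_iff algebra_simps)
    then have "r (c (Suc k)) one_fun = r (c k) one_fun + r one_fun one_fun"
      by (simp only: add[OF cV one_fun(1) one_fun])
    then show ?case using Suc self[OF one_fun(1)] by (simp add: add.commute)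
  qed
  define v where "v x = c n x - u x" for x
  have "u x \<le> real n" "0 \<le> u x" if "x \<in> carrier G" for x
    using C n that assms by (force simp: ell_infty_pos_def le_fun_def)+
  then have "v \<in> V"
    using C(2) by (auto simp: v_def c_def ell_infty_pos_def ell_infty_iff le_fun_def indicator_def
        intro!: exI[of _ "real n"])
  moreover have "c n = u + v" by (auto simp: v_def fun_eq_iff)
  ultimately have "of_nat n = r u one_fun + r v one_fun"
    using add[OF assms _ one_fun] c[of n] by simp
  then show ?thesis by (metis ennreal_add_eq_top infinity_ennreal_def ennreal_of_nat_neq_top)
qed

definition mean_pos where "mean_pos u = enn2real (r u one_fun)"

definition mean where "mean f = mean_pos (\<lambda>x. max (f x) 0) - mean_pos (\<lambda>x. max (- f x) 0)"

lemma mean_pos_add: "u \<in> V \<Longrightarrow> v \<in> V \<Longrightarrow> mean_pos (u + v) = mean_pos u + mean_pos v"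
  using price_one_finite[of u] price_one_finite[of v]
  by (simp only: mean_pos_def add[OF _ _ one_fun]) (simp add: enn2real_plus less_top)

lemma pos_part:
  assumes "f \<in> ell_infty G"
  shows "(\<lambda>x. max (f x) 0) \<in> V"
proof -
  obtain C where "\<forall>x\<in>carrier G. \<bar>f x\<bar> \<le> C" "\<forall>x. x \<notin> carrier G \<longrightarrow> f x = 0"
    using assms by (auto simp: ell_infty_iff)
  then show ?thesis
    by (auto simp: ell_infty_pos_def ell_infty_iff le_fun_def max_def intro!: exI[of _ C])
qed

lemma neg_part: "f \<in> ell_infty G \<Longrightarrow> (\<lambda>x. max (- f x) 0) \<in> V"
  using pos_part[OF ell_infty_minus, of f] by simp

text \<open>The value of \<open>mean\<close> does not depend on the decomposition into a difference
  of positive functions. This yields additivity although positive parts are not additive.\<close>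

lemma mean_diff:
  assumes f: "f \<in> ell_infty G" and uv: "u \<in> V" "v \<in> V" and eq: "\<And>x. f x = u x - v x"
  shows "mean f = mean_pos u - mean_pos v"
proof -
  have "(\<lambda>x. max (f x) 0) + v = u + (\<lambda>x. max (- f x) 0)"
    by (auto simp: fun_eq_iff eq max_def)
  then have "mean_pos (\<lambda>x. max (f x) 0) + mean_pos v = mean_pos u + mean_pos (\<lambda>x. max (- f x) 0)"
    using mean_pos_add uv pos_part[OF f] neg_part[OF f] by metis
  then show ?thesis by (simp add: mean_def)
qed

text \<open>Translations fix \<open>one_fun\<close>, so for prices relative to it equivariance
  becomes invariance.\<close>

lemma invariant_mean: "invariant_mean G mean"
proof unfold_locales
  fix f f' assume f: "f \<in> ell_infty G" and f': "f' \<in> ell_infty G"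
  let ?p = "\<lambda>f x. max (f x) (0::real)" and ?n = "\<lambda>f x. max (- f x) (0::real)"
  have "mean (f + f') = mean_pos (?p f + ?p f') - mean_pos (?n f + ?n f')"
    by (rule mean_diff)
      (use f f' in \<open>simp_all only: ell_infty_add ell_infty_pos_add pos_part neg_part\<close>, simp add: max_def)
  also have "\<dots> = (mean_pos (?p f) + mean_pos (?p f')) - (mean_pos (?n f) + mean_pos (?n f'))"
    using mean_pos_add[OF pos_part[OF f] pos_part[OF f']] mean_pos_add[OF neg_part[OF f] neg_part[OF f']]
    by argo
  finally show "mean (f + f') = mean f + mean f'" by (simp add: mean_def)
next
  fix f assume f: "f \<in> V"
  have "mean_pos 0 = 0" using zero_left[OF one_fun] by (simp add: mean_pos_def)
  moreover have "mean f = mean_pos f - mean_pos 0"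
    by (rule mean_diff[OF _ f ell_infty_pos_zero]) (use f in \<open>simp_all add: ell_infty_pos_def\<close>)
  ultimately have "mean f = mean_pos f" by linarith
  then show "0 \<le> mean f" by (simp add: mean_pos_def)
next
  have "mean_pos 0 = 0" using zero_left[OF one_fun] by (simp add: mean_pos_def)
  moreover have "mean one_fun = mean_pos one_fun - mean_pos 0"
    by (rule mean_diff[OF _ one_fun(1) ell_infty_pos_zero])
      (use one_fun(1) in \<open>simp_all add: ell_infty_pos_def\<close>)
  ultimately have "mean one_fun = mean_pos one_fun" by linarith
  then show "mean one_fun = 1" using self[OF one_fun(1)] by (simp add: mean_pos_def)
next
  fix g f assume g: "g \<in> carrier G" and f: "f \<in> ell_infty G"
  have inv: "mean_pos (translate G g u) = mean_pos u" if "u \<in> V" for u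
    using translate_both[OF g that one_fun(1)] translate_indicator_carrier[OF g]
    by (simp add: mean_pos_def)
  have "mean (translate G g f) = mean_pos (translate G g (\<lambda>x. max (f x) 0))
      - mean_pos (translate G g (\<lambda>x. max (- f x) 0))"
    by (rule mean_diff)
      (use g f pos_part neg_part ell_infty_pos_translate ell_infty_translate[OF is_group] in
        \<open>auto simp: translate_def\<close>)
  then show "mean (translate G g f) = mean f"
    using inv pos_part[OF f] neg_part[OF f] by (simp add: mean_def)
qed

text \<open>Finiteness of the price between translates of \<open>u\<close> is a left preorder: total
  by \<open>price_cases\<close>, transitive by \<open>price_finite_trans\<close>, left invariant by
  equivariance. Its triviality is the claim.\<close>

lemma price_translate_finite:
  assumes fg: "finitely_generated_group G" and epi: "epi G integer_group = {}"
    and u: "u \<in> V" and g: "g \<in> carrier G" "h \<in> carrier G"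
  shows "r (translate G g u) (translate G h u) \<noteq> \<infinity>"
proof -
  define le where "le x y \<longleftrightarrow> r (translate G x u) (translate G y u) \<noteq> \<infinity>" for x y
  interpret m: invariant_mean G mean by (rule invariant_mean)
  interpret left_preorder_mean G le mean
  proof unfold_locales
    fix x y assume xy: "x \<in> carrier G" "y \<in> carrier G"
    show "le x y \<or> le y x"
      using price_cases ell_infty_pos_translate[OF _ u] xy by (simp add: le_def)
    fix z assume z: "z \<in> carrier G"
    show "le x z" if "le x y" "le y z"
      using price_finite_trans ell_infty_pos_translate[OF _ u] xy z that unfolding le_def by blast
  next
    fix z x y assume "z \<in> carrier G" "x \<in> carrier G" "y \<in> carrier G" "le x y"
    then show "le (z \<otimes> x) (z \<otimes> y)"
      using translate_both ell_infty_pos_translate[OF _ u] by (simp add: le_def translate_translate[symmetric])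
  qed
  show ?thesis using trivial_if_no_epi[OF fg epi g] by (simp add: le_def)
qed

lemma invariant:
  assumes fg: "finitely_generated_group G" and epi: "epi G integer_group = {}"
  shows "vp_invariant G r"
proof -
  have one: "r (translate G g u) u = 1" if g: "g \<in> carrier G" and u: "u \<in> V" for g u
  proof -
    define \<rho> where "\<rho> x = r (translate G x u) u" for x
    have u1: "translate G \<one> u = u" using translate_one u by (simp add: ell_infty_pos_def)
    have T: "translate G x u \<in> V" if "x \<in> carrier G" for x using ell_infty_pos_translate that u by blast
    have fin: "\<rho> x \<noteq> \<infinity>" "r u (translate G x u) \<noteq> \<infinity>" if "x \<in> carrier G" for x
      using price_translate_finite[OF fg epi u, of x \<one>] price_translate_finite[OF fg epi u, of \<one> x]
        that u1 by (auto simp: \<rho>_def)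
    \<comment> \<open>The prices in both directions are finite, so their product is defined and
      equals 1.\<close>
    have "\<rho> x \<noteq> 0" if "x \<in> carrier G" for x
      using mult[of u "translate G x u" u] self[OF u] fin[OF that] T[OF that] u
      by (auto simp: mult_defined_def \<rho>_def)
    then have pos: "enn2real (\<rho> x) > 0" if "x \<in> carrier G" for x
      using fin[OF that] that by (simp add: enn2real_positive_iff less_top zero_less_iff_neq_zero)
    have hom: "\<rho> (x \<otimes> y) = \<rho> x * \<rho> y" if xy: "x \<in> carrier G" "y \<in> carrier G" for x y
    proof -
      have yx: "r (translate G (x \<otimes> y) u) (translate G x u) = \<rho> y"
        using translate_both[OF xy(1) T[OF xy(2)] u] xy by (simp add: \<rho>_def translate_translate)
      have "\<rho> (x \<otimes> y) = \<rho> y * \<rho> x"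
        using mult[of "translate G (x \<otimes> y) u" "translate G x u" u] yx fin xy T u
        by (simp add: \<rho>_def[symmetric] mult_defined_def)
      then show ?thesis by (simp add: mult.commute)
    qed
    have "ln (enn2real (\<rho> g)) = 0"
      using real_hom_trivial[OF fg epi _ g, of "\<lambda>x. ln (enn2real (\<rho> x))"] pos
      by (simp add: hom enn2real_mult ln_mult_pos)
    then have "enn2real (\<rho> g) = 1" using pos[OF g] by simp
    then show ?thesis using fin(1)[OF g] ennreal_enn2real[of "\<rho> g"] by (simp add: \<rho>_def less_top)
  qed
  show ?thesis
    unfolding vp_invariant_def
  proof (intro ballI)
    fix g u v assume g: "g \<in> carrier G" and uv: "u \<in> V" "v \<in> V"
    \<comment> \<open>The first factor is 1, so the product is defined even when
      \<open>r u v\<close> is 0 or infinite.\<close>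
    show "r (translate G g u) v = r u v"
      using mult[of "translate G g u" u v] one[OF g uv(1)] ell_infty_pos_translate[OF g uv(1)] uv
      by (simp add: mult_defined_def)
  qed
qed

end

section \<open>Conditional means\<close>

lemma ennreal_mult_divide_mult:
  assumes "0 \<le> a" "0 \<le> b" "0 < (s::real)"
  shows "ennreal (a * s) / ennreal (b * s) = ennreal a / ennreal b"
proof (cases "b = 0")
  case True
  then show ?thesis using assms by (cases "a = 0") (auto simp: ennreal_divide_zero)
next
  case False
  then show ?thesis using assms by (simp add: divide_ennreal)
qed

locale equivariant_conditional_mean = group G for G :: "('a, 'b) monoid_scheme" (structure) +
  fixes P :: "('a \<Rightarrow> real) \<Rightarrow> ('a \<Rightarrow> real) \<Rightarrow> real"
  assumes cm: "conditional_mean G P" and equivariant: "cm_equivariant G P"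
begin

abbreviation V where "V \<equiv> ell_infty_pos G"

lemma V_iff: "u \<in> V \<longleftrightarrow> u \<in> ell_infty G \<and> 0 \<le> u"
  by (simp add: ell_infty_pos_def)

lemma nonneg: "u \<in> V \<Longrightarrow> v \<in> V \<Longrightarrow> u \<le> v \<Longrightarrow> v \<noteq> 0 \<Longrightarrow> 0 \<le> P u v"
  and add: "u \<in> V \<Longrightarrow> v \<in> V \<Longrightarrow> w \<in> V \<Longrightarrow> u + v \<le> w \<Longrightarrow> w \<noteq> 0 \<Longrightarrow> P (u + v) w = P u w + P v w"
  and mult: "u \<in> V \<Longrightarrow> v \<in> V \<Longrightarrow> w \<in> V \<Longrightarrow> u \<le> v \<Longrightarrow> v \<le> w \<Longrightarrow> v \<noteq> 0 \<Longrightarrow> P u w = P u v * P v w"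
  and self: "u \<in> V \<Longrightarrow> u \<noteq> 0 \<Longrightarrow> P u u = 1"
  using cm unfolding conditional_mean_def cond_pair_def V_iff by (auto simp del: plus_fun_apply)

lemma zero_left: "w \<in> V \<Longrightarrow> w \<noteq> 0 \<Longrightarrow> P 0 w = 0"
  using add[OF ell_infty_pos_zero ell_infty_pos_zero, of w] unfolding add_0 V_iff by simp

lemma le_add: "u \<in> V \<Longrightarrow> v \<in> V \<Longrightarrow> u \<le> u + v" "u \<in> V \<Longrightarrow> v \<in> V \<Longrightarrow> v \<le> u + v"
  by (auto simp: V_iff le_fun_def)

lemma add_eq_zero: "u \<in> V \<Longrightarrow> v \<in> V \<Longrightarrow> u + v = 0 \<longleftrightarrow> u = 0 \<and> v = 0"
  by (auto simp: V_iff le_fun_def fun_eq_iff add_nonneg_eq_0_iff)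

text \<open>For \<open>u\<close> and \<open>v\<close> not both zero, the two values of
  \<open>P\<close> sum to 1, so the quotient is never 0/0. The pair of zeros lies outside the domain
  of \<open>P\<close> and gets the value 1 that a pricing demands.\<close>

definition price where
  "price u v = (if u = 0 \<and> v = 0 then 1 else ennreal (P u (u + v)) / ennreal (P v (u + v)))"

text \<open>Passing from \<open>u + v\<close> to a larger reference \<open>t\<close> multiplies both
  values by \<open>P (u + v) t\<close>, which is positive by assumption and cancels.\<close>

lemma price_ratio:
  assumes V: "u \<in> V" "v \<in> V" "t \<in> V" and le: "u + v \<le> t" "t \<noteq> 0" and pos: "P u t + P v t > 0"
  shows "price u v = ennreal (P u t) / ennreal (P v t)"
proof -
  note W = ell_infty_pos_add[OF V(1,2)]
  have sum: "P (u + v) t = P u t + P v t" using add[OF V le] .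
  then have ne: "u + v \<noteq> 0" using pos zero_left[OF V(3) le(2)] by auto
  have "P u t = P u (u + v) * P (u + v) t" "P v t = P v (u + v) * P (u + v) t"
    using mult[OF V(1) W V(3) le_add(1)[OF V(1,2)] le(1) ne]
      mult[OF V(2) W V(3) le_add(2)[OF V(1,2)] le(1) ne] by auto
  moreover have "0 \<le> P u (u + v)" "0 \<le> P v (u + v)"
    using nonneg[OF V(1) W le_add(1)[OF V(1,2)] ne] nonneg[OF V(2) W le_add(2)[OF V(1,2)] ne] .
  moreover have "P (u + v) t > 0" using sum pos by simp
  ultimately have "ennreal (P u t) / ennreal (P v t) = ennreal (P u (u + v)) / ennreal (P v (u + v))"
    by (simp only: ennreal_mult_divide_mult)
  moreover have "\<not> (u = 0 \<and> v = 0)" using ne add_eq_zero[OF V(1,2)] by blast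
  ultimately show ?thesis unfolding price_def by (simp only: if_False)
qed

text \<open>With the single reference \<open>u + v + w\<close>, the axioms for prices become
  arithmetic of three nonnegative numbers with sum 1.\<close>

lemma common_bound:
  assumes V: "u \<in> V" "v \<in> V" "w \<in> V" and ne: "\<not> (u = 0 \<and> v = 0 \<and> w = 0)"
  obtains t where "t \<in> V" "t \<noteq> 0" "u + v \<le> t" "u + w \<le> t" "v + w \<le> t" "u + v + w \<le> t"
    "0 \<le> P u t" "0 \<le> P v t" "0 \<le> P w t" "P u t + P v t + P w t = 1" "P (u + v) t = P u t + P v t"
proof
  define t where "t = u + v + w"
  have W: "u + v \<in> V" using ell_infty_pos_add V by blast
  show t: "t \<in> V" unfolding t_def using ell_infty_pos_add V W by blast
  show t0: "t \<noteq> 0"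
    using ne add_eq_zero[OF W V(3)] add_eq_zero[OF V(1,2)] unfolding t_def by blast
  show le: "u + v \<le> t" "u + w \<le> t" "v + w \<le> t" "u + v + w \<le> t"
    using V by (auto simp: t_def V_iff le_fun_def)
  have "u \<le> t" "v \<le> t" "w \<le> t" using V by (auto simp: t_def V_iff le_fun_def add_nonneg_nonneg)
  then show "0 \<le> P u t" "0 \<le> P v t" "0 \<le> P w t" using nonneg V t t0 by blast+
  show sum: "P (u + v) t = P u t + P v t" using add[OF V(1,2) t le(1) t0] .
  have "P t t = P (u + v) t + P w t"
    using add[OF W V(3) t le(4) t0] by (simp only: t_def)
  then show "P u t + P v t + P w t = 1" using self[OF t t0] sum by simp
qed

lemma price_vector_pricing: "vector_pricing G price"
  unfolding vector_pricing_def
proof (intro ballI conjI impI)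
  fix u v w assume V: "u \<in> V" "v \<in> V" "w \<in> V"
  note W = ell_infty_pos_add[OF V(1,2)]
  show "price u u = 1"
  proof (cases "u = 0")
    case False
    then obtain t where t: "t \<in> V" "t \<noteq> 0" "u + u \<le> t" "0 \<le> P u t" "P u t + P u t + P 0 t = 1"
      using common_bound[OF V(1) V(1) ell_infty_pos_zero] by metis
    then have "P u t = 1/2" using zero_left[OF t(1,2)] by simp
    then show ?thesis using price_ratio[OF V(1) V(1) t(1,3,2)] by (simp add: divide_ennreal)
  qed (simp add: price_def)
  show "price (u + v) w = price u w + price v w" if "w \<noteq> 0"
  proof -
    have ne: "\<not> (u = 0 \<and> v = 0 \<and> w = 0)" using that by blast
    obtain t where t: "t \<in> V" "t \<noteq> 0" and le: "u + v \<le> t" "u + w \<le> t" "v + w \<le> t" "u + v + w \<le> t"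
      and nn: "0 \<le> P u t" "0 \<le> P v t" "0 \<le> P w t" and sum: "P u t + P v t + P w t = 1"
      and uv: "P (u + v) t = P u t + P v t"
      by (rule common_bound[OF V ne], rule that)
    have "price (u + v) w = ennreal (P u t + P v t) / ennreal (P w t)"
      using price_ratio[OF W V(3) t(1) le(4) t(2)] sum uv by simp
    moreover have "price u w = ennreal (P u t) / ennreal (P w t)" if "P u t + P w t > 0"
      using price_ratio[OF V(1,3) t(1) le(2) t(2) that] .
    moreover have "price v w = ennreal (P v t) / ennreal (P w t)" if "P v t + P w t > 0"
      using price_ratio[OF V(2,3) t(1) le(3) t(2) that] .
    \<comment> \<open>In the first two cases one price on the right is infinite, so the other, which
      \<open>t\<close> may fail to determine, does not affect the sum.\<close>
    moreover have "P w t = 0 \<and> P u t > 0 \<or> P w t = 0 \<and> P v t > 0 \<or> P w t > 0"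
      using nn sum by linarith
    ultimately show ?thesis
      using nn by (auto simp: divide_ennreal add_divide_distrib ennreal_plus[symmetric] simp del: ennreal_plus)
  qed
  show "price u w = price u v * price v w" if md: "mult_defined (price u v) (price v w)"
  proof (cases "u = 0 \<and> v = 0 \<and> w = 0")
    case False
    obtain t where t: "t \<in> V" "t \<noteq> 0" and le: "u + v \<le> t" "u + w \<le> t" "v + w \<le> t" "u + v + w \<le> t"
      and nn: "0 \<le> P u t" "0 \<le> P v t" "0 \<le> P w t" and sum: "P u t + P v t + P w t = 1"
      by (rule common_bound[OF V False], rule that)
    note uv = price_ratio[OF V(1,2) t(1) le(1) t(2)]
      and uw = price_ratio[OF V(1,3) t(1) le(2) t(2)]
      and vw = price_ratio[OF V(2,3) t(1) le(3) t(2)]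
    \<comment> \<open>In the first two cases one factor is not determined by \<open>t\<close>: it is
      multiplied by 0 in the first, and in the second it is nonzero because the product with
      infinity is defined. The last two cases are the undefined products of 0 and infinity.\<close>
    consider "P u t = 0" "P v t = 0" "P w t > 0" | "P v t = 0" "P w t = 0" "P u t > 0"
      | "P v t > 0" "P w t > 0" | "P v t > 0" "P w t = 0" "P u t > 0" | "P v t > 0" "P w t = 0" "P u t = 0"
      | "P v t = 0" "P w t > 0" "P u t > 0"
      using nn sum by linarith
    then show ?thesis
    proof cases
      case 1
      then show ?thesis using uw vw by simp
    next
      case 2
      then show ?thesis using uv uw md by (auto simp: mult_defined_def ennreal_top_mult)
    next
      case 3
      then show ?thesis using uv uw vw nn by (simp add: divide_ennreal ennreal_mult[symmetric])
    next
      case 4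
      then show ?thesis using uv uw vw by (simp add: divide_ennreal ennreal_mult_top)
    next
      case 5
      then show ?thesis using uv vw md by (simp add: mult_defined_def)
    next
      case 6
      then show ?thesis using uv vw md by (simp add: mult_defined_def)
    qed
  qed (simp add: price_def)
qed

lemma price_equivariant: "vp_equivariant G price"
  unfolding vp_equivariant_def
proof (intro ballI)
  fix g u v assume g: "g \<in> carrier G" and V: "u \<in> V" "v \<in> V"
  have zero: "translate G g u = 0 \<longleftrightarrow> u = 0" "translate G g v = 0 \<longleftrightarrow> v = 0"
    using translate_eq_zero_iff g V by (auto simp: V_iff)
  have "P (translate G g x) (translate G g (u + v)) = P x (u + v)"
    if "x \<in> V" "x \<le> u + v" "u + v \<noteq> 0" for x
    using equivariant g that ell_infty_pos_add[OF V] unfolding cm_equivariant_def cond_pair_def V_iff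
    by blast
  then show "price (translate G g u) (translate G g v) = price u v"
    using V le_add[OF V] add_eq_zero[OF V] unfolding price_def zero translate_add[symmetric] by auto
qed

text \<open>\<open>P u (u + v)\<close> factors through \<open>v\<close>, and
  \<open>P v (u + v)\<close> cancels: were it zero, both values would vanish, although they sum to
  1. Thus invariance of \<open>price\<close> returns to \<open>P\<close>.\<close>

lemma price_eq:
  assumes V: "u \<in> V" "v \<in> V" "u \<le> v" "v \<noteq> 0"
  shows "price u v = ennreal (P u v)"
proof -
  note W = ell_infty_pos_add[OF V(1,2)]
  have ne: "u + v \<noteq> 0" using V(4) add_eq_zero[OF V(1,2)] by blast
  have sum: "P u (u + v) + P v (u + v) = 1"
    using add[OF V(1,2) W order.refl ne] self[OF W ne] by simp
  have eq: "P u (u + v) = P u v * P v (u + v)"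
    using mult[OF V(1,2) W V(3) le_add(2)[OF V(1,2)] V(4)] .
  have "P v (u + v) \<noteq> 0" using eq sum by auto
  then have "P v (u + v) > 0" using nonneg[OF V(2) W le_add(2)[OF V(1,2)] ne] by simp
  then have "ennreal (P u v * P v (u + v)) / ennreal (1 * P v (u + v)) = ennreal (P u v) / ennreal 1"
    using nonneg[OF V] by (intro ennreal_mult_divide_mult) auto
  moreover have "ennreal (P u v) / ennreal 1 = ennreal (P u v)"
    using divide_ennreal[OF nonneg[OF V], of 1] by simp
  ultimately show ?thesis using V(4) unfolding price_def eq by simp
qed

lemma invariant:
  assumes "finitely_generated_group G" and "epi G integer_group = {}"
  shows "cm_invariant G P"
proof -
  interpret price: equivariant_vector_pricing G price
    by unfold_locales (rule price_vector_pricing price_equivariant)+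
  have inv: "vp_invariant G price" by (rule price.invariant[OF assms])
  show ?thesis
    unfolding cm_invariant_def
  proof (intro ballI allI impI)
    fix g u v
    assume g: "g \<in> carrier G" and uv: "cond_pair G u v \<and> cond_pair G (translate G g u) v"
    then have V: "u \<in> V" "v \<in> V" "translate G g u \<in> V" and le: "u \<le> v" "translate G g u \<le> v" "v \<noteq> 0"
      using order.trans[of 0 u v] by (auto simp: cond_pair_def V_iff)
    have "price (translate G g u) v = price u v"
      using inv g V unfolding vp_invariant_def by blast
    then show "P (translate G g u) v = P u v"
      using price_eq V le nonneg by simp
  qed
qed

end

theorem proposition8:
  fixes G :: "('a, 'b) monoid_scheme"
  assumes "finitely_generated_group G"
    and "epi G integer_group = {}"
  shows "(\<forall>P. conditional_mean G P \<and> cm_equivariant G P \<longrightarrow> cm_invariant G P) \<and>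
         (\<forall>r. vector_pricing G r \<and> vp_equivariant G r \<longrightarrow> vp_invariant G r)"
proof -
  have G: "group G" using assms(1) by (simp add: finitely_generated_group_def)
  have "cm_invariant G P" if "conditional_mean G P" "cm_equivariant G P" for P
    using equivariant_conditional_mean.invariant[OF _ assms] G that
    by (simp add: equivariant_conditional_mean_def equivariant_conditional_mean_axioms_def)
  moreover have "vp_invariant G r" if "vector_pricing G r" "vp_equivariant G r" for r
    using equivariant_vector_pricing.invariant[OF _ assms] G that
    by (simp add: equivariant_vector_pricing_def equivariant_vector_pricing_axioms_def)
  ultimately show ?thesis by blast
qed

end
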